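(* Let $p$ be a prime and let $\mathcal{O}$ and $\mathcal{O}'$ be two maximal orders of $B_p$. Let $D_1 \le D_2 \le D_3$ be the successive minima of $\mathcal{O}^T$, and let $x, y, z \in \mathcal{O}^T$ be linearly independent elements with $\mathrm{Nr}(x)=D_1$, $\mathrm{Nr}(y)=D_2$, $\mathrm{Nr}(z)=D_3$. Suppose that each of the integers $D_1$, $D_2$, $\mathrm{Nr}(x+y)$, $\mathrm{Nr}(x-y)$ and $D_3$ is represented optimally by $\mathcal{O}'^T$, and that $\theta'_{\mathcal{O}^T}(D_3) \leq \theta'_{\mathcal{O}'^T}(D_3)$. Assume furthermore that \[ D_1 D_2 < \tfrac{16}{3}p, \qquad 15 \le D_1, \qquad 286 < p. \] Then $\mathcal{O}$ and $\mathcal{O}'$ are of the same type.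
   Context: $B_p$ is the quaternion algebra over $\mathbb{Q}$ ramified exactly at $p$ and $\infty$, with canonical involution $x\mapsto\bar x$, reduced trace $\mathrm{Tr}(x)=x+\bar x$ and reduced norm $\mathrm{Nr}(x)=x\bar x$ (positive definite). An order is a subring containing $\mathbb{Z}$ that is a $\mathbb{Z}$-lattice of rank $4$; maximal means not properly contained in another order. Two orders $\mathcal{O},\mathcal{O}'$ are of the same type if $c\mathcal{O}c^{-1}=\mathcal{O}'$ for some nonzero $c\in B_p$. For an order $\mathcal{O}$, $\mathcal{O}^T := \{2a-\mathrm{Tr}(a): a\in\mathcal{O}\}$, a rank-$3$ lattice. Successive minima of a rank-$n$ lattice $\Lambda$: $D_i$ is the least real number such that $\Lambda$ contains $i$ linearly independent vectors each of norm $\mathrm{Nr}\le D_i$. An element $v=a_1v_1+\dots+a_nv_n$ of $\Lambda=\langle v_1,\dots,v_n\rangle$ is primitive if $\gcd(a_1,\dots,a_n)=1$. An integer $k$ is represented optimally by $\Lambda$ if there is a primitive $v\in\Lambda$ with $\mathrm{Nr}(v)=k$, and the optimal multiplicity is $\theta'_\Lambda(k)=\tfrac12\#\{v\in\Lambda \text{ primitive} : \mathrm{Nr}(v)=k\}$. *)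

theory Defs
  imports
    "HOL-Analysis.Cartesian_Space"
    "HOL-Computational_Algebra.Primes"
    "HOL-Algebra.QuotRing"
begin

subsection \<open>The quaternion algebra $(a,b \mid \mathbf{Q})$\<close>

text \<open>
  A vector \<open>x\<close> of length 4 stands for \<open>x$1 + x$2 i + x$3 j + x$4 ij\<close>, where
  \<open>i\<^sup>2 = a\<close>, \<open>j\<^sup>2 = b\<close>, \<open>ji = -ij\<close>.
  Every quaternion algebra over the rationals is isomorphic to one of these with \<open>a, b \<noteq> 0\<close>.
\<close>

type_synonym quat = "rat ^ 4"

definition qone :: quat where
  "qone = vector [1, 0, 0, 0]"

definition qmult :: "rat \<Rightarrow> rat \<Rightarrow> quat \<Rightarrow> quat \<Rightarrow> quat" where
  "qmult a b x y = vector
     [x$1 * y$1 + a * x$2 * y$2 + b * x$3 * y$3 - a * b * x$4 * y$4,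
      x$1 * y$2 + x$2 * y$1 - b * x$3 * y$4 + b * x$4 * y$3,
      x$1 * y$3 + x$3 * y$1 + a * x$2 * y$4 - a * x$4 * y$2,
      x$1 * y$4 + x$4 * y$1 + x$2 * y$3 - x$3 * y$2]"

definition qconj :: "quat \<Rightarrow> quat" where
  "qconj x = vector [x$1, - x$2, - x$3, - x$4]"

text \<open>
  \<open>x + qconj x\<close> and \<open>qmult a b x (qconj x)\<close> are rational multiples of \<open>qone\<close>
  (lemmas \<open>qtr_qone\<close> and \<open>qnr_qone\<close> below); trace and norm are the corresponding rationals.
\<close>

definition qtr :: "quat \<Rightarrow> rat" where
  "qtr x = (x + qconj x) $ 1"

definition qnr :: "rat \<Rightarrow> rat \<Rightarrow> quat \<Rightarrow> rat" where
  "qnr a b x = qmult a b x (qconj x) $ 1"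

lemma vector_4_nth [simp]:
  "(vector [w, x, y, z] :: 'a::zero ^ 4) $ 1 = w"
  "(vector [w, x, y, z] :: 'a::zero ^ 4) $ 2 = x"
  "(vector [w, x, y, z] :: 'a::zero ^ 4) $ 3 = y"
  "(vector [w, x, y, z] :: 'a::zero ^ 4) $ 4 = z"
  by (simp_all add: vector_def)

lemma qmult_assoc: "qmult a b (qmult a b x y) z = qmult a b x (qmult a b y z)"
  by (simp add: vec_eq_iff forall_4 qmult_def algebra_simps)

lemma qmult_qone [simp]: "qmult a b qone x = x" "qmult a b x qone = x"
  by (simp_all add: vec_eq_iff forall_4 qmult_def qone_def)

lemma qtr_qone: "x + qconj x = qtr x *s qone"
  by (simp add: vec_eq_iff forall_4 qtr_def qconj_def qone_def)

lemma qnr_qone: "qmult a b x (qconj x) = qnr a b x *s qone"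
  by (simp add: vec_eq_iff forall_4 qnr_def qmult_def qconj_def qone_def)


subsection \<open>Ramification\<close>

definition padic_abs :: "nat \<Rightarrow> rat \<Rightarrow> real" where
  "padic_abs l x = (if x = 0 then 0 else
     case quotient_of x of (m, n) \<Rightarrow>
       real l powi (int (multiplicity (int l) n) - int (multiplicity (int l) m)))"

definition abs_Cauchy :: "(rat \<Rightarrow> real) \<Rightarrow> (nat \<Rightarrow> rat) \<Rightarrow> bool" where
  "abs_Cauchy v u \<longleftrightarrow> (\<forall>e>0. \<exists>N. \<forall>m\<ge>N. \<forall>n\<ge>N. v (u m - u n) < e)"

definition abs_null :: "(rat \<Rightarrow> real) \<Rightarrow> (nat \<Rightarrow> rat) \<Rightarrow> bool" where
  "abs_null v u \<longleftrightarrow> (\<lambda>n. v (u n)) \<longlonglongrightarrow> 0"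

text \<open>
  For an absolute value \<open>v\<close> on the rationals with completion \<open>Q\<^sub>v\<close> (Cauchy sequences modulo
  null sequences), the algebra \<open>B \<otimes> Q\<^sub>v\<close> consists of quaternions with coordinates in \<open>Q\<^sub>v\<close>.
  It is therefore the ring of coordinatewise Cauchy sequences of quaternions modulo
  coordinatewise null sequences.
\<close>

definition quat_Cauchy_ring :: "(rat \<Rightarrow> real) \<Rightarrow> rat \<Rightarrow> rat \<Rightarrow> (nat \<Rightarrow> quat) ring" where
  "quat_Cauchy_ring v a b =
     \<lparr>carrier = {u. \<forall>i. abs_Cauchy v (\<lambda>n. u n $ i)},
      mult = (\<lambda>u w n. qmult a b (u n) (w n)), one = (\<lambda>n. qone),
      zero = (\<lambda>n. 0), add = (\<lambda>u w n. u n + w n)\<rparr>"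

definition quat_null_ideal :: "(rat \<Rightarrow> real) \<Rightarrow> (nat \<Rightarrow> quat) set" where
  "quat_null_ideal v = {u. \<forall>i. abs_null v (\<lambda>n. u n $ i)}"

definition local_quat_algebra :: "(rat \<Rightarrow> real) \<Rightarrow> rat \<Rightarrow> rat \<Rightarrow> (nat \<Rightarrow> quat) set ring" where
  "local_quat_algebra v a b = quat_Cauchy_ring v a b Quot quat_null_ideal v"

text \<open>Ramified means that the local algebra is a division ring.\<close>

definition ramified_at :: "(rat \<Rightarrow> real) \<Rightarrow> rat \<Rightarrow> rat \<Rightarrow> bool" where
  "ramified_at v a b \<longleftrightarrow>
     Units (local_quat_algebra v a b) =
       carrier (local_quat_algebra v a b) - {\<zero>\<^bsub>local_quat_algebra v a b\<^esub>}"

definition ramified_exactly_at_p_and_infinity :: "nat \<Rightarrow> rat \<Rightarrow> rat \<Rightarrow> bool" where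
  "ramified_exactly_at_p_and_infinity p a b \<longleftrightarrow>
     a \<noteq> 0 \<and> b \<noteq> 0 \<and>
     ramified_at (\<lambda>x. \<bar>real_of_rat x\<bar>) a b \<and>
     (\<forall>l. prime l \<longrightarrow> (ramified_at (padic_abs l) a b \<longleftrightarrow> l = p))"


subsection \<open>Lattices\<close>

definition lattice_basis :: "nat \<Rightarrow> (nat \<Rightarrow> quat) \<Rightarrow> quat set \<Rightarrow> bool" where
  "lattice_basis n v L \<longleftrightarrow>
     inj_on v {..<n} \<and> vec.independent (v ` {..<n}) \<and>
     L = {(\<Sum>i<n. rat_of_int (c i) *s v i) | c. True}"

definition is_lattice :: "nat \<Rightarrow> quat set \<Rightarrow> bool" where
  "is_lattice n L \<longleftrightarrow> (\<exists>v. lattice_basis n v L)"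

definition is_successive_minimum ::
    "rat \<Rightarrow> rat \<Rightarrow> quat set \<Rightarrow> nat \<Rightarrow> real \<Rightarrow> bool" where
  "is_successive_minimum a b L i D \<longleftrightarrow>
     (let P = (\<lambda>D'. \<exists>S\<subseteq>L. finite S \<and> card S = i \<and> vec.independent S \<and>
                       (\<forall>s\<in>S. real_of_rat (qnr a b s) \<le> D'))
      in P D \<and> (\<forall>D'. P D' \<longrightarrow> D \<le> D'))"

text \<open>Primitivity does not depend on the chosen basis of the rank \<open>n\<close> lattice \<open>L\<close>.\<close>

definition primitive_in :: "nat \<Rightarrow> quat set \<Rightarrow> quat \<Rightarrow> bool" where
  "primitive_in n L x \<longleftrightarrow>
     (\<exists>v c. lattice_basis n v L \<and> x = (\<Sum>i<n. rat_of_int (c i) *s v i) \<and>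
            Gcd (c ` {..<n}) = 1)"

definition represented_optimally ::
    "rat \<Rightarrow> rat \<Rightarrow> nat \<Rightarrow> quat set \<Rightarrow> real \<Rightarrow> bool" where
  "represented_optimally a b n L k \<longleftrightarrow>
     (\<exists>v. primitive_in n L v \<and> real_of_rat (qnr a b v) = k)"

definition optimal_multiplicity ::
    "rat \<Rightarrow> rat \<Rightarrow> nat \<Rightarrow> quat set \<Rightarrow> real \<Rightarrow> real" where
  "optimal_multiplicity a b n L k =
     real (card {v. primitive_in n L v \<and> real_of_rat (qnr a b v) = k}) / 2"


subsection \<open>Orders\<close>

definition is_order :: "rat \<Rightarrow> rat \<Rightarrow> quat set \<Rightarrow> bool" where
  "is_order a b R \<longleftrightarrow>
     qone \<in> R \<and> (\<forall>x\<in>R. \<forall>y\<in>R. x - y \<in> R \<and> qmult a b x y \<in> R) \<and> is_lattice 4 R"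

definition is_maximal_order :: "rat \<Rightarrow> rat \<Rightarrow> quat set \<Rightarrow> bool" where
  "is_maximal_order a b R \<longleftrightarrow>
     is_order a b R \<and> \<not> (\<exists>R'. is_order a b R' \<and> R \<subset> R')"

text \<open>Here \<open>d\<close> is the inverse of \<open>c\<close>.\<close>

definition same_type :: "rat \<Rightarrow> rat \<Rightarrow> quat set \<Rightarrow> quat set \<Rightarrow> bool" where
  "same_type a b R R' \<longleftrightarrow>
     (\<exists>c d. c \<noteq> 0 \<and> qmult a b c d = qone \<and> qmult a b d c = qone \<and>
            (\<lambda>x. qmult a b (qmult a b c x) d) ` R = R')"

definition trace_lattice :: "quat set \<Rightarrow> quat set" where
  "trace_lattice R = (\<lambda>u. 2 *s u - qtr u *s qone) ` R"

end

theory Submission imports Defs "HOL-Number_Theory.Cong" begin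

text \<open>
  Write \<open>x = 2\<alpha> - Tr \<alpha>\<close> and \<open>y = 2\<beta> - Tr \<beta>\<close>, and let \<open>n = Nr(x) Nr(y) - \<langle>x, y\<rangle>\<^sup>2\<close> be the Gram
  determinant.  The order \<open>\<langle>1, \<alpha>, \<beta>, \<alpha>\<beta>\<rangle>\<close> has reduced discriminant \<open>n / 4\<close>, which is a multiple of
  \<open>p\<close> because the algebra is ramified at \<open>p\<close>.  The bound on \<open>D\<^sub>1 D\<^sub>2\<close> forces \<open>n = 4p\<close>, and then that
  order is all of \<open>O\<close>.  Likewise elements of norms \<open>D\<^sub>1\<close> and \<open>D\<^sub>2\<close> in the trace lattice of
  \<open>O'\<close> have Gram determinant \<open>4p\<close> and generate \<open>O'\<close>, unless they are parallel; in that case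
  \<open>D\<^sub>1 = D\<^sub>2\<close>, and an element of norm \<open>Nr(x - y)\<close> or \<open>Nr(x + y)\<close> replaces the second one.  So both trace
  lattices contain isometric generating pairs, and by Skolem-Noether such pairs are conjugate.
\<close>

subsection \<open>The norm form\<close>

text \<open>Ramification enters only through one consequence: if a local algebra is a division ring,
  then a Cauchy sequence of quaternions whose norms tend to 0 tends to 0 itself. At infinity this
  makes the norm form definite. At \<open>p\<close>, a nontrivial zero of the norm form modulo
  \<open>p\<close> would lift to integer coefficient sequences violating it; excluding such zeros
  makes \<open>p\<close> divide \<open>n\<close>.

  Integrality of traces and norms in an order makes \<open>n\<close> divisible by 4 as well, so for
  odd \<open>p\<close> it is a multiple of \<open>4p\<close>. It is nonzero because \<open>x\<close>
  and \<open>y\<close> are independent, positive by definiteness, and at most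
  \<open>Nr(x) Nr(y) < 16p/3 < 8p\<close>; only \<open>4p\<close> remains.

  That the generated order is everything is proved coordinate by coordinate. Gram determinants of
  pairs and triples in a trace lattice are multiples of \<open>4p\<close> and \<open>4p^2\<close>;
  this shows that the squares of the coordinates other than that of 1 are integers, and a rational
  number with integral square is an integer. The coordinate of 1 follows from integrality of
  norms.\<close>

text \<open>The bilinear form \<open>Tr(x y\<^sup>*) / 2\<close> of the reduced norm.\<close>

definition qip :: "rat \<Rightarrow> rat \<Rightarrow> quat \<Rightarrow> quat \<Rightarrow> rat" where
  "qip a b x y = x$1 * y$1 - a * x$2 * y$2 - b * x$3 * y$3 + a * b * x$4 * y$4"

lemma qnr_eq_qip: "qnr a b x = qip a b x x"
  by (simp add: qnr_def qip_def qmult_def qconj_def)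

lemma qip_commute: "qip a b x y = qip a b y x"
  by (simp add: qip_def algebra_simps)

lemma qip_add: "qip a b (x + y) z = qip a b x z + qip a b y z" "qip a b z (x + y) = qip a b z x + qip a b z y"
  by (simp_all add: qip_def algebra_simps)

lemma qip_diff: "qip a b (x - y) z = qip a b x z - qip a b y z" "qip a b z (x - y) = qip a b z x - qip a b z y"
  by (simp_all add: qip_def algebra_simps)

lemma qip_scale: "qip a b (r *s x) z = r * qip a b x z" "qip a b z (r *s x) = r * qip a b z x"
  by (simp_all add: qip_def algebra_simps)

lemma qip_uminus: "qip a b (- x) z = - qip a b x z" "qip a b z (- x) = - qip a b z x"
  by (simp_all add: qip_def algebra_simps)

lemmas qip_linear = qip_add qip_diff qip_scale qip_uminus

lemma qmult_linear:
  "qmult a b (x + y) z = qmult a b x z + qmult a b y z"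
  "qmult a b z (x + y) = qmult a b z x + qmult a b z y"
  "qmult a b (x - y) z = qmult a b x z - qmult a b y z"
  "qmult a b z (x - y) = qmult a b z x - qmult a b z y"
  "qmult a b (- x) z = - qmult a b x z"
  "qmult a b z (- x) = - qmult a b z x"
  "qmult a b (r *s x) z = r *s qmult a b x z"
  "qmult a b z (r *s x) = r *s qmult a b z x"
  by (simp_all add: vec_eq_iff forall_4 qmult_def algebra_simps)

lemma qmult_0 [simp]: "qmult a b 0 x = 0" "qmult a b x 0 = 0"
  by (simp_all add: vec_eq_iff forall_4 qmult_def)

lemma qnr_qmult: "qnr a b (qmult a b x y) = qnr a b x * qnr a b y"
  by (simp add: qnr_def qmult_def qconj_def algebra_simps)

subsection \<open>Absolute values on the rationals\<close>

text \<open>Covers the real and the p-adic absolute values at once, so that the zero divisor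
  criterion against ramification is proved only once.\<close>

locale rat_abs_value =
  fixes v :: "rat \<Rightarrow> real"
  assumes eq_0_iff [simp]: "v x = 0 \<longleftrightarrow> x = 0"
    and nonneg [simp]: "0 \<le> v x"
    and mult: "v (x * y) = v x * v y"
    and triangle: "v (x + y) \<le> v x + v y"
begin

lemma one [simp]: "v 1 = 1"
  using mult[of 1 1] by simp

lemma minus [simp]: "v (- x) = v x"
proof -
  have "v (- 1) * v (- 1) = 1" using mult[of "-1" "-1"] by simp
  then have "(v (- 1))\<^sup>2 = 1\<^sup>2" by (simp add: power2_eq_square)
  then have "v (- 1) = 1" by (rule power2_eq_imp_eq) auto
  then show ?thesis using mult[of "-1" x] by simp
qed

lemma abs_null_const_iff: "abs_null v (\<lambda>n. c) \<longleftrightarrow> c = 0"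
  by (simp add: abs_null_def LIMSEQ_const_iff)

lemma abs_null_add: "abs_null v f \<Longrightarrow> abs_null v g \<Longrightarrow> abs_null v (\<lambda>n. f n + g n)"
  unfolding abs_null_def
  by (rule tendsto_sandwich[where f = "\<lambda>n. 0" and h = "\<lambda>n. v (f n) + v (g n)"])
     (auto intro!: tendsto_add_zero always_eventually triangle)

lemma abs_null_minus: "abs_null v f \<Longrightarrow> abs_null v (\<lambda>n. - f n)"
  by (simp add: abs_null_def)

lemma abs_null_diff: "abs_null v f \<Longrightarrow> abs_null v g \<Longrightarrow> abs_null v (\<lambda>n. f n - g n)"
  using abs_null_add[of f "\<lambda>n. - g n"] abs_null_minus by simp

lemma abs_Cauchy_bounded:
  assumes "abs_Cauchy v g" shows "\<exists>K. \<forall>n. v (g n) \<le> K"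
proof -
  obtain N where N: "\<And>m n. m \<ge> N \<Longrightarrow> n \<ge> N \<Longrightarrow> v (g m - g n) < 1"
    using assms unfolding abs_Cauchy_def by (meson zero_less_one)
  have "v (g n) \<le> Max ((\<lambda>k. v (g k)) ` {..N}) + 1" for n
  proof (cases "n \<le> N")
    case True
    then have "v (g n) \<le> Max ((\<lambda>k. v (g k)) ` {..N})" by (intro Max_ge) auto
    then show ?thesis by linarith
  next
    case False
    have "v (g n) \<le> v (g n - g N) + v (g N)" using triangle[of "g n - g N" "g N"] by simp
    also have "\<dots> \<le> 1 + Max ((\<lambda>k. v (g k)) ` {..N})"
      using N[of n N] False by (intro add_mono Max_ge) auto
    finally show ?thesis by simp
  qed
  then show ?thesis by blast
qed

lemma abs_null_mult_Cauchy:
  assumes "abs_null v f" "abs_Cauchy v g" shows "abs_null v (\<lambda>n. f n * g n)"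
proof -
  obtain K where K: "\<And>n. v (g n) \<le> K" using abs_Cauchy_bounded[OF assms(2)] by blast
  show ?thesis unfolding abs_null_def
  proof (rule tendsto_sandwich[where f = "\<lambda>n. 0" and h = "\<lambda>n. v (f n) * K"])
    show "\<forall>\<^sub>F n in sequentially. v (f n * g n) \<le> v (f n) * K"
      by (intro always_eventually allI) (simp add: mult K mult_left_mono)
    show "(\<lambda>n. v (f n) * K) \<longlonglongrightarrow> 0"
      using assms(1) unfolding abs_null_def by (rule tendsto_mult_left_zero)
  qed auto
qed

lemma abs_Cauchy_const [simp]: "abs_Cauchy v (\<lambda>n. c)"
  using eq_0_iff[of 0] by (simp add: abs_Cauchy_def del: eq_0_iff)

lemma abs_Cauchy_add:
  assumes "abs_Cauchy v f" "abs_Cauchy v g" shows "abs_Cauchy v (\<lambda>n. f n + g n)"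
  unfolding abs_Cauchy_def
proof (intro allI impI)
  fix e :: real assume e: "e > 0"
  obtain N where N: "\<And>m n. m \<ge> N \<Longrightarrow> n \<ge> N \<Longrightarrow> v (f m - f n) < e/2"
    using assms(1) e unfolding abs_Cauchy_def by (meson half_gt_zero)
  obtain M where M: "\<And>m n. m \<ge> M \<Longrightarrow> n \<ge> M \<Longrightarrow> v (g m - g n) < e/2"
    using assms(2) e unfolding abs_Cauchy_def by (meson half_gt_zero)
  have "v (f m + g m - (f n + g n)) < e" if "m \<ge> max N M" "n \<ge> max N M" for m n
    using triangle[of "f m - f n" "g m - g n"] N[of m n] M[of m n] that
    by (simp add: algebra_simps)
  then show "\<exists>N. \<forall>m\<ge>N. \<forall>n\<ge>N. v (f m + g m - (f n + g n)) < e" by blast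
qed

lemma abs_Cauchy_mult_const:
  assumes "abs_Cauchy v f" shows "abs_Cauchy v (\<lambda>n. f n * c)"
proof (cases "c = 0")
  case False
  then have c: "v c > 0" using nonneg[of c] eq_0_iff[of c] by linarith
  show ?thesis unfolding abs_Cauchy_def
  proof (intro allI impI)
    fix e :: real assume e: "e > 0"
    then obtain N where N: "\<And>m n. m \<ge> N \<Longrightarrow> n \<ge> N \<Longrightarrow> v (f m - f n) < e / v c"
      using assms c unfolding abs_Cauchy_def by (meson divide_pos_pos)
    have "v (f m * c - f n * c) < e" if "m \<ge> N" "n \<ge> N" for m n
      using N[OF that] c mult[of "f m - f n" c] by (simp add: field_simps)
    then show "\<exists>N. \<forall>m\<ge>N. \<forall>n\<ge>N. v (f m * c - f n * c) < e" by blast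
  qed
qed simp

lemma abs_null_qmult:
  assumes "\<And>i. abs_null v (\<lambda>n. E n $ i)" "\<And>i. abs_Cauchy v (\<lambda>n. F n $ i)"
  shows "abs_null v (\<lambda>n. qmult a b (E n) (F n) $ i)"
proof -
  have *: "abs_null v (\<lambda>n. E n $ k * F n $ l)" for k l
    by (rule abs_null_mult_Cauchy[OF assms])
  have c: "abs_null v (\<lambda>n. r * E n $ k * F n $ l)" for r k l
    using abs_null_mult_Cauchy[OF *[of k l], of "\<lambda>n. r"] by (simp add: mult_ac)
  show ?thesis
    using exhaust_4[of i] by (auto simp: qmult_def intro!: abs_null_add abs_null_diff c *)
qed

text \<open>
  If \<open>Q\<close> had an inverse \<open>W\<close> in the local algebra, then
  \<open>(W Q - 1) Q\<^sup>* = Nr(Q) W - Q\<^sup>*\<close> and \<open>Nr(Q) W\<close> would both be null, hence so would \<open>Q\<close>.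
\<close>

lemma not_ramified_at_if_null_norm:
  assumes Q: "\<And>i. abs_Cauchy v (\<lambda>n. Q n $ i)"
    and N: "abs_null v (\<lambda>n. qnr a b (Q n))"
    and nn: "\<not> abs_null v (\<lambda>n. Q n $ j)"
  shows "\<not> ramified_at v a b"
proof
  assume ram: "ramified_at v a b"
  let ?C = "quat_Cauchy_ring v a b" and ?I = "quat_null_ideal v"
  have zI: "(\<lambda>n. 0) \<in> ?I" by (simp add: quat_null_ideal_def abs_null_const_iff)
  have QC: "Q \<in> carrier ?C" using Q by (simp add: quat_Cauchy_ring_def)
  have cos: "?I +>\<^bsub>?C\<^esub> u = {(\<lambda>n. h n + u n) | h. h \<in> ?I}" for u
    by (auto simp: a_r_coset_def r_coset_def quat_Cauchy_ring_def)
  have mem: "u \<in> ?I +>\<^bsub>?C\<^esub> u" for u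
  proof -
    have "u = (\<lambda>n. (\<lambda>n. 0) n + u n)" by simp
    then show ?thesis unfolding cos using zI by (intro CollectI exI conjI)
  qed
  have in1: "?I +>\<^bsub>?C\<^esub> Q \<in> carrier (local_quat_algebra v a b)"
    using QC by (auto simp: local_quat_algebra_def FactRing_def A_RCOSETS_def RCOSETS_def a_r_coset_def)
  have "Q \<notin> ?I" using nn by (auto simp: quat_null_ideal_def)
  then have "?I +>\<^bsub>?C\<^esub> Q \<noteq> \<zero>\<^bsub>local_quat_algebra v a b\<^esub>"
    using mem[of Q] by (auto simp: local_quat_algebra_def FactRing_def)
  then have "?I +>\<^bsub>?C\<^esub> Q \<in> Units (local_quat_algebra v a b)"
    using ram in1 unfolding ramified_at_def by blast
  then obtain X where X: "X \<in> carrier (local_quat_algebra v a b)"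
    and one: "X \<otimes>\<^bsub>local_quat_algebra v a b\<^esub> (?I +>\<^bsub>?C\<^esub> Q) = \<one>\<^bsub>local_quat_algebra v a b\<^esub>"
    unfolding Units_def by blast
  obtain W where W: "W \<in> carrier ?C" and XW: "X = ?I +>\<^bsub>?C\<^esub> W"
    using X by (auto simp: local_quat_algebra_def FactRing_def A_RCOSETS_def RCOSETS_def a_r_coset_def)
  have "W \<otimes>\<^bsub>?C\<^esub> Q \<in> rcoset_mult ?C ?I X (?I +>\<^bsub>?C\<^esub> Q)"
    unfolding rcoset_mult_def using mem XW by blast
  also have "\<dots> = ?I +>\<^bsub>?C\<^esub> \<one>\<^bsub>?C\<^esub>"
    using one by (simp add: local_quat_algebra_def FactRing_def)
  finally obtain h where h: "h \<in> ?I" and eq: "(\<lambda>n. qmult a b (W n) (Q n)) = (\<lambda>n. h n + qone)"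
    unfolding cos by (auto simp: quat_Cauchy_ring_def)
  have hq: "qmult a b (h n) (qconj (Q n)) = qnr a b (Q n) *s W n - qconj (Q n)" for n
  proof -
    have "h n = qmult a b (W n) (Q n) - qone" using fun_cong[OF eq, of n] by simp
    then show ?thesis
      by (simp add: qmult_linear qmult_assoc qnr_qone)
  qed
  have conjC: "abs_Cauchy v (\<lambda>n. qconj (Q n) $ i)" for i
    using exhaust_4[of i] abs_Cauchy_mult_const[OF Q, of _ "-1"] Q by (auto simp: qconj_def)
  have 1: "abs_null v (\<lambda>n. qmult a b (h n) (qconj (Q n)) $ i)" for i
    by (rule abs_null_qmult[OF _ conjC]) (use h in \<open>auto simp: quat_null_ideal_def\<close>)
  have 2: "abs_null v (\<lambda>n. qnr a b (Q n) * W n $ i)" for i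
    by (rule abs_null_mult_Cauchy[OF N]) (use W in \<open>auto simp: quat_Cauchy_ring_def\<close>)
  have 3: "abs_null v (\<lambda>n. qconj (Q n) $ i)" for i
    using abs_null_diff[OF 2[of i] 1[of i]] by (simp add: hq)
  have "abs_null v (\<lambda>n. Q n $ j)"
    using exhaust_4[of j] 3[of j] abs_null_minus[OF 3[of j]] by (auto simp: qconj_def)
  then show False using nn by blast
qed

end

lemma rat_abs_value_real: "rat_abs_value (\<lambda>x. \<bar>real_of_rat x\<bar>)"
  by unfold_locales (auto simp: of_rat_mult of_rat_add abs_mult simp del: abs_of_rat)

lemma rat_Cauchy_seq_to_real:
  obtains u :: "nat \<Rightarrow> rat" where "(\<lambda>n. real_of_rat (u n)) \<longlonglongrightarrow> r"
    and "abs_Cauchy (\<lambda>x. \<bar>real_of_rat x\<bar>) u"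
proof -
  have "\<exists>q::rat. \<bar>real_of_rat q - r\<bar> < inverse (Suc n)" for n
  proof -
    have "inverse (real (Suc n)) > 0" by simp
    then have "r - inverse (real (Suc n)) < r + inverse (real (Suc n))" by linarith
    from of_rat_dense[OF this] show ?thesis by (auto simp: abs_less_iff algebra_simps)
  qed
  then obtain u :: "nat \<Rightarrow> rat" where u: "\<And>n. \<bar>real_of_rat (u n) - r\<bar> < inverse (Suc n)" by metis
  have lim: "(\<lambda>n. real_of_rat (u n)) \<longlonglongrightarrow> r"
    by (rule LIM_zero_cancel, rule tendsto_0_le[OF LIMSEQ_inverse_real_of_nat, where K = 1])
       (use u in \<open>auto intro!: always_eventually less_imp_le\<close>)
  have "Cauchy (\<lambda>n. real_of_rat (u n))" using lim LIMSEQ_imp_Cauchy by blast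
  then have "abs_Cauchy (\<lambda>x. \<bar>real_of_rat x\<bar>) u"
    unfolding abs_Cauchy_def Cauchy_def dist_real_def by (simp add: of_rat_diff)
  then show ?thesis using lim that by blast
qed

text \<open>Over the reals \<open>\<surd>c + e\<close> is a zero divisor if \<open>e\<^sup>2 = c \<ge> 0\<close>.\<close>

lemma not_ramified_at_infinity_if_square_pos:
  assumes e: "qip a b e qone = 0" "e $ j = 1" and c: "qnr a b e = - c" "c \<ge> 0" and j: "j \<noteq> 1"
  shows "\<not> ramified_at (\<lambda>x. \<bar>real_of_rat x\<bar>) a b"
proof -
  interpret rat_abs_value "\<lambda>x. \<bar>real_of_rat x\<bar>" by (rule rat_abs_value_real)
  obtain u where u: "(\<lambda>n. real_of_rat (u n)) \<longlonglongrightarrow> sqrt (real_of_rat c)"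
    and uC: "abs_Cauchy (\<lambda>x. \<bar>real_of_rat x\<bar>) u"
    by (rule rat_Cauchy_seq_to_real)
  let ?Q = "\<lambda>n. u n *s qone + e"
  show ?thesis
  proof (rule not_ramified_at_if_null_norm[of ?Q _ _ j])
    show "abs_Cauchy (\<lambda>x. \<bar>real_of_rat x\<bar>) (\<lambda>n. ?Q n $ i)" for i
      using abs_Cauchy_add[OF abs_Cauchy_mult_const[OF uC, of "qone $ i"] abs_Cauchy_const[of "e $ i"]]
      by simp
    have N: "qnr a b (?Q n) = (u n)\<^sup>2 - c" for n
      using e c by (simp add: qnr_eq_qip qip_linear qip_commute[of _ _ qone] power2_eq_square qip_def qone_def)
    have "(\<lambda>n. (real_of_rat (u n))\<^sup>2) \<longlonglongrightarrow> (sqrt (real_of_rat c))\<^sup>2"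
      by (intro tendsto_intros u)
    then have "(\<lambda>n. (real_of_rat (u n))\<^sup>2) \<longlonglongrightarrow> real_of_rat c" using c by simp
    then show "abs_null (\<lambda>x. \<bar>real_of_rat x\<bar>) (\<lambda>n. qnr a b (?Q n))"
      unfolding abs_null_def N by (simp add: of_rat_diff of_rat_power LIM_zero_iff tendsto_rabs_zero_iff)
    have "?Q n $ j = 1" for n using e j exhaust_4[of j] by (auto simp: qone_def)
    then show "\<not> abs_null (\<lambda>x. \<bar>real_of_rat x\<bar>) (\<lambda>n. ?Q n $ j)"
      by (simp only: abs_null_const_iff one_neq_zero not_False_eq_True)
  qed
qed

text \<open>The generators have trace zero and squares \<open>a\<close> and \<open>b\<close>; a
  nonnegative square would give a zero divisor over the reals.\<close>

lemma ramified_at_infinity_imp_negative: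
  assumes "ramified_at (\<lambda>x. \<bar>real_of_rat x\<bar>) a b"
  shows "a < 0" "b < 0"
proof -
  show "a < 0"
  proof (rule ccontr)
    assume "\<not> a < 0"
    then show False
      using not_ramified_at_infinity_if_square_pos[of a b "vector [0,1,0,0]" 2 a] assms
      by (simp add: qnr_eq_qip qip_def qone_def)
  qed
  show "b < 0"
  proof (rule ccontr)
    assume "\<not> b < 0"
    then show False
      using not_ramified_at_infinity_if_square_pos[of a b "vector [0,0,1,0]" 3 b] assms
      by (simp add: qnr_eq_qip qip_def qone_def)
  qed
qed

subsection \<open>The p-adic absolute value\<close>

text \<open>\<open>padic_abs\<close> is defined by the reduced fraction. Cross-multiplication and
  additivity of multiplicities show that every fraction gives the same exponent.\<close>

lemma padic_abs_fraction:
  assumes l: "prime l" and "m \<noteq> 0" "n \<noteq> 0"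
  shows "padic_abs l (of_int m / of_int n) =
    real l powi (int (multiplicity (int l) n) - int (multiplicity (int l) m))"
proof -
  obtain m' n' where q: "quotient_of (of_int m / of_int n) = (m', n')" by (cases "quotient_of (of_int m / of_int n)")
  have n': "n' > 0" using quotient_of_denom_pos[OF q] .
  have eq: "of_int m / of_int n = (of_int m' / of_int n' :: rat)" using quotient_of_div[OF q] .
  have m': "m' \<noteq> 0" using eq assms n' by auto
  have "of_int (m * n') = (of_int (m' * n) :: rat)" using eq assms n' by (simp add: field_simps)
  then have "m * n' = m' * n" by (simp only: of_int_eq_iff)
  then have "multiplicity (int l) (m * n') = multiplicity (int l) (m' * n)" by simp
  then have "multiplicity (int l) m + multiplicity (int l) n' = multiplicity (int l) m' + multiplicity (int l) n"
    using l assms n' m' by (simp add: prime_elem_multiplicity_mult_distrib)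
  then have "int (multiplicity (int l) n') - int (multiplicity (int l) m') =
      int (multiplicity (int l) n) - int (multiplicity (int l) m)" by linarith
  then show ?thesis using assms q by (simp add: padic_abs_def)
qed

lemma padic_abs_of_int_le:
  assumes l: "prime l" and d: "int l ^ k dvd m"
  shows "padic_abs l (of_int m) \<le> (1 / real l) ^ k"
proof (cases "m = 0")
  case False
  have l1: "real l > 1" using prime_gt_1_nat[OF l] by simp
  have "k \<le> multiplicity (int l) m"
    using d False prime_gt_1_nat[OF l] by (intro multiplicity_geI) auto
  then have "real l powi (- int (multiplicity (int l) m)) \<le> real l powi (- int k)"
    using l1 by (intro power_int_increasing) auto
  also have "\<dots> = (1 / real l) ^ k" by (simp add: power_int_minus field_simps)
  finally show ?thesis using padic_abs_fraction[OF l False, of 1] by simp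
qed (simp add: padic_abs_def)

lemma padic_abs_of_int_le_1: "prime l \<Longrightarrow> padic_abs l (of_int m) \<le> 1"
  using padic_abs_of_int_le[of l 0 m] by simp

lemma rat_abs_value_padic:
  assumes l: "prime l" shows "rat_abs_value (padic_abs l)"
proof
  have l1: "real l > 1" using prime_gt_1_nat[OF l] by simp
  show pos: "0 \<le> padic_abs l x" for x
    by (auto simp: padic_abs_def split: prod.splits)
  show z: "padic_abs l x = 0 \<longleftrightarrow> x = 0" for x
    using l1 by (auto simp: padic_abs_def split: prod.splits)
  show mul: "padic_abs l (x * y) = padic_abs l x * padic_abs l y" for x y
  proof (cases "x = 0 \<or> y = 0")
    case False
    obtain m n where x: "x = of_int m / of_int n" "n \<noteq> 0"
      by (metis quotient_of_div quotient_of_denom_pos prod.exhaust less_irrefl)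
    obtain m' n' where y: "y = of_int m' / of_int n'" "n' \<noteq> 0"
      by (metis quotient_of_div quotient_of_denom_pos prod.exhaust less_irrefl)
    have nz: "m \<noteq> 0" "m' \<noteq> 0" using False x y by auto
    have xy: "x * y = of_int (m * m') / of_int (n * n')" using x y by simp
    have "padic_abs l (x * y) = real l powi (int (multiplicity (int l) (n * n')) - int (multiplicity (int l) (m * m')))"
      unfolding xy by (rule padic_abs_fraction[OF l]) (use x y nz in auto)
    also have "\<dots> = real l powi ((int (multiplicity (int l) n) - int (multiplicity (int l) m)) +
        (int (multiplicity (int l) n') - int (multiplicity (int l) m')))"
      using x y nz l by (simp add: prime_elem_multiplicity_mult_distrib algebra_simps)
    also have "\<dots> = padic_abs l x * padic_abs l y"
      using x y nz l l1 by (simp add: padic_abs_fraction power_int_add)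
    finally show ?thesis .
  qed (auto simp: padic_abs_def)
  \<comment> \<open>Core of the ultrametric inequality: such an \<open>x\<close> has a reduced
    denominator prime to \<open>l\<close>, hence so does \<open>1 + x\<close>. The general case
    follows on dividing by the larger summand.\<close>
  have max1: "padic_abs l (1 + x) \<le> 1" if "padic_abs l x \<le> 1" for x
  proof (cases "x = 0")
    case False
    obtain m n where q: "quotient_of x = (m, n)" by (cases "quotient_of x")
    have x: "x = of_int m / of_int n" and n: "n > 0" and co: "coprime m n"
      using quotient_of_div[OF q] quotient_of_denom_pos[OF q] quotient_of_coprime[OF q] by auto
    have m: "m \<noteq> 0" using False x by auto
    have "multiplicity (int l) n = 0"
    proof (rule ccontr)
      assume A: "multiplicity (int l) n \<noteq> 0"
      then have "int l dvd n" by (metis not_dvd_imp_multiplicity_0)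
      then have "\<not> int l dvd m" using co l by (meson coprime_common_divisor not_prime_unit prime_int_nat_transfer prime_nat_int_transfer)
      then have "multiplicity (int l) m = 0" by (rule not_dvd_imp_multiplicity_0)
      then have "padic_abs l x = real l ^ multiplicity (int l) n"
        using padic_abs_fraction[OF l m, of n] n x by (simp add: power_int_def)
      then show False using that A l1 by (metis one_less_power not_le not_gr_zero)
    qed
    then have n1: "padic_abs l (of_int n) = 1"
      using padic_abs_fraction[OF l, of n 1] n by simp
    have "of_int (m + n) = (1 + x) * of_int n" using n by (simp add: x field_simps)
    then have "padic_abs l (1 + x) = padic_abs l (of_int (m + n))"
      using mul[of "1 + x" "of_int n"] n1 by simp
    then show ?thesis using padic_abs_of_int_le_1[OF l] by metis
  qed (use padic_abs_of_int_le_1[OF l, of 1] in simp)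
  have um: "padic_abs l (x + y) \<le> padic_abs l x" if "padic_abs l y \<le> padic_abs l x" for x y
  proof (cases "x = 0")
    case True
    then have "padic_abs l y = 0" using that pos[of y] z[of 0] by simp
    then show ?thesis using True z by simp
  next
    case False
    have px: "padic_abs l x > 0" using False pos[of x] z[of x] by linarith
    have "padic_abs l (y / x) * padic_abs l x = padic_abs l y" using mul[of "y / x" x] False by simp
    then have "padic_abs l (y / x) * padic_abs l x \<le> 1 * padic_abs l x" using that by simp
    then have "padic_abs l (y / x) \<le> 1" using px by (rule mult_right_le_imp_le)
    from max1[OF this] have "padic_abs l (1 + y / x) * padic_abs l x \<le> 1 * padic_abs l x"
      by (rule mult_right_mono) (rule pos)
    moreover have "x + y = (1 + y / x) * x" using False by (simp add: field_simps)
    ultimately show ?thesis using mul[of "1 + y / x" x] by simp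
  qed
  show "padic_abs l (x + y) \<le> padic_abs l x + padic_abs l y" for x y
    using um[of y x] um[of x y] pos[of x] pos[of y] by (cases "padic_abs l y \<le> padic_abs l x") (simp_all add: add.commute)
qed

section \<open>Square roots modulo powers of an odd prime\<close>

text \<open>Pigeonhole: \<open>P^2\<close> and \<open>B - A X^2\<close> each take
  \<open>(p + 1) / 2\<close> residues modulo \<open>p\<close>, so they share a value.\<close>

lemma prime_quadratic_form_represents:
  fixes p A B :: int
  assumes p: "prime p" "p > 2" and A: "\<not> p dvd A"
  obtains P X where "p dvd P\<^sup>2 + A * X\<^sup>2 - B"
proof -
  define h where "h = p div 2"
  have ph: "p = 2 * h + 1"
  proof -
    have "odd p" using p prime_odd_int by auto
    then show ?thesis unfolding h_def by presburger
  qed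
  have inj: "inj_on (\<lambda>x. (c + d * x\<^sup>2) mod p) {0..h}" if d: "\<not> p dvd d" for c d
  proof (rule inj_onI)
    fix x y assume xy: "x \<in> {0..h}" "y \<in> {0..h}" and eq: "(c + d * x\<^sup>2) mod p = (c + d * y\<^sup>2) mod p"
    have "p dvd (c + d * x\<^sup>2) - (c + d * y\<^sup>2)" using eq by (simp add: mod_eq_dvd_iff)
    then have "p dvd d * ((x - y) * (x + y))" by (simp add: power2_eq_square algebra_simps)
    then consider "p dvd x - y" | "p dvd x + y" using p d by (meson prime_dvd_mult_iff)
    then show "x = y"
    proof cases
      case 1
      then have "x - y \<noteq> 0 \<Longrightarrow> \<bar>p\<bar> \<le> \<bar>x - y\<bar>" by (intro dvd_imp_le_int)
      then show ?thesis using xy ph by fastforce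
    next
      case 2
      then have "x + y = 0" using xy ph zdvd_not_zless[of "x + y" p] by fastforce
      then show ?thesis using xy by auto
    qed
  qed
  \<comment> \<open>The redundant \<open>0 +\<close> and \<open>1 *\<close> make this an instance of
    \<open>inj\<close> with \<open>c = 0\<close> and \<open>d = 1\<close>.\<close>
  define S where "S = (\<lambda>x. (0 + 1 * x\<^sup>2) mod p) ` {0..h}"
  define T where "T = (\<lambda>x. (B + (- A) * x\<^sup>2) mod p) ` {0..h}"
  have "\<not> p dvd 1" using p by simp
  then have cS: "card S = nat (h + 1)" and cT: "card T = nat (h + 1)"
    unfolding S_def T_def using A by (simp_all only: card_image[OF inj] dvd_minus_iff not_False_eq_True) (simp_all)
  have "S \<union> T \<subseteq> {0..<p}" unfolding S_def T_def using p by auto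
  then have "card (S \<union> T) \<le> nat p" using card_mono[of "{0..<p}" "S \<union> T"] by simp
  moreover have "h \<ge> 0" using p by (simp add: h_def)
  ultimately have "S \<inter> T \<noteq> {}"
    using card_Un_disjoint[of S T] cS cT ph by (auto simp: S_def T_def)
  then obtain P X where "P\<^sup>2 mod p = (B - A * X\<^sup>2) mod p" unfolding S_def T_def by auto
  then have "p dvd P\<^sup>2 - (B - A * X\<^sup>2)" by (simp add: mod_eq_dvd_iff)
  then show ?thesis using that[of P X] by (simp add: algebra_simps)
qed

text \<open>Newton iteration. The induction also carries \<open>p\<close> not dividing
  \<open>f n\<close>, which keeps \<open>2 * f n\<close> invertible modulo the odd prime
  \<open>p\<close>.\<close>

lemma hensel_square_root_sequence:
  fixes p w u0 :: int
  assumes p: "prime p" "p > 2" and u0: "\<not> p dvd u0" and r: "p dvd u0\<^sup>2 - w"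
  obtains f :: "nat \<Rightarrow> int" where "\<And>n. p ^ Suc n dvd (f n)\<^sup>2 - w"
    and "\<And>n. p ^ Suc n dvd f (Suc n) - f n"
proof -
  have "\<exists>f. \<forall>n. (\<not> p dvd f n \<and> p ^ Suc n dvd (f n)\<^sup>2 - w) \<and> p ^ Suc n dvd f (Suc n) - f n"
  proof (rule dependent_nat_choice)
    show "\<exists>x. \<not> p dvd x \<and> p ^ Suc 0 dvd x\<^sup>2 - w" using u0 r by auto
  next
    fix u n assume u: "\<not> p dvd u \<and> p ^ Suc n dvd u\<^sup>2 - w"
    then obtain e where e: "u\<^sup>2 - w = p ^ Suc n * e" by (auto elim: dvdE)
    have "\<not> p dvd 2" using p by (auto dest: zdvd_imp_le)
    then have "\<not> p dvd 2 * u" using u p prime_dvd_mult_iff by blast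
    then have "coprime (2 * u) p" using p by (metis coprime_commute prime_imp_coprime)
    then obtain i where "[2 * u * i = 1] (mod p)" using cong_solve_coprime_int by blast
    then obtain g where g: "2 * u * i = 1 + p * g" by (metis cong_iff_lin cong_sym)
    \<comment> \<open>An inverse \<open>i\<close> of \<open>2 * u\<close> modulo \<open>p\<close>
      alone suffices: its defect \<open>p * g\<close> is multiplied by an error already divisible by
      \<open>p ^ Suc n\<close>.\<close>
    let ?u = "u + (- e * i) * p ^ Suc n"
    have "?u\<^sup>2 - w = (u\<^sup>2 - w) - 2 * u * i * e * p ^ Suc n + (e * i)\<^sup>2 * p ^ Suc n * p ^ Suc n"
      by (simp add: power2_eq_square algebra_simps)
    also have "\<dots> = p ^ Suc n * e - (1 + p * g) * e * p ^ Suc n + (e * i)\<^sup>2 * p ^ Suc n * p ^ Suc n"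
      by (simp only: e g)
    also have "\<dots> = p ^ Suc (Suc n) * (- g * e + (e * i)\<^sup>2 * p ^ n)"
      by (simp add: algebra_simps)
    finally have "p ^ Suc (Suc n) dvd ?u\<^sup>2 - w" by simp
    moreover have "\<not> p dvd ?u" using u by (simp add: dvd_diff_left_iff dvd_diff_right_iff)
    moreover have "p ^ Suc n dvd ?u - u" by simp
    ultimately show "\<exists>y. (\<not> p dvd y \<and> p ^ Suc (Suc n) dvd y\<^sup>2 - w) \<and> p ^ Suc n dvd y - u" by blast
  qed
  then show ?thesis using that by blast
qed

lemma padic_null_if_dvd:
  assumes l: "prime l" and d: "\<And>n. int l ^ Suc n dvd f n"
  shows "abs_null (padic_abs l) (\<lambda>n. of_int (f n))"
proof -
  interpret rat_abs_value "padic_abs l" by (rule rat_abs_value_padic[OF l])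
  have "(\<lambda>n. (1 / real l) ^ Suc n) \<longlonglongrightarrow> 0"
    using prime_gt_1_nat[OF l] by (intro LIMSEQ_Suc LIMSEQ_power_zero) auto
  then show ?thesis unfolding abs_null_def
    by (rule tendsto_sandwich[OF always_eventually always_eventually tendsto_const, rotated 2])
       (auto intro: padic_abs_of_int_le[OF l d, simplified])
qed

lemma padic_Cauchy_if_dvd:
  assumes l: "prime l" and d: "\<And>n. int l ^ Suc n dvd f (Suc n) - f n"
  shows "abs_Cauchy (padic_abs l) (\<lambda>n. of_int (f n))"
  unfolding abs_Cauchy_def
proof (intro allI impI)
  interpret rat_abs_value "padic_abs l" by (rule rat_abs_value_padic[OF l])
  have dd: "int l ^ Suc n dvd f (n + k) - f n" for n k
  proof (induction k)
    case (Suc k)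
    have "int l ^ Suc n dvd f (Suc (n + k)) - f (n + k)"
      using d[of "n + k"] by (rule power_le_dvd) simp
    from dvd_add[OF this Suc] show ?case by simp
  qed simp
  fix e :: real assume "e > 0"
  then obtain N where N: "(1 / real l) ^ N < e"
    using real_arch_pow_inv[of e "1 / real l"] prime_gt_1_nat[OF l] by auto
  have "padic_abs l (of_int (f m) - of_int (f n)) < e" if mn: "m \<ge> N" "n \<ge> N" for m n
  proof -
    have "int l ^ Suc N dvd (f m - f N) - (f n - f N)"
      using dd[of N "m - N"] dd[of N "n - N"] mn by (intro dvd_diff[of _ "f m - f N"]) simp_all
    then have "int l ^ N dvd f m - f n" by (simp add: dvd_mult_right)
    from padic_abs_of_int_le[OF l this] N show ?thesis by simp
  qed
  then show "\<exists>N. \<forall>m\<ge>N. \<forall>n\<ge>N. padic_abs l (of_int (f m) - of_int (f n)) < e" by blast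
qed

section \<open>Ramification at \<open>p\<close> and Gram determinants\<close>

text \<open>Along a Hensel sequence \<open>f n\<close> for a square root of \<open>w\<close>, the
  norms of \<open>q0 + f n q1\<close> tend to 0, while the inner product with \<open>e\<close> keeps
  its nonzero value \<open>qip a b q0 e\<close>. So the sequence is not null although its norms are.
  Leaving \<open>q0\<close>, \<open>q1\<close> and \<open>k\<close> free lets the root be lifted in
  any chosen direction.\<close>

lemma not_ramified_at_if_isotropic_mod:
  fixes w u0 k :: int
  assumes p: "prime p" "p > 2" and u0: "\<not> int p dvd u0" and r: "int p dvd u0\<^sup>2 - w"
    and N: "\<And>u::int. qnr a b (q0 + of_int u *s q1) = of_int (k * (u\<^sup>2 - w))"
    and e: "qip a b q1 e = 0" "qip a b q0 e \<noteq> 0"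
  shows "\<not> ramified_at (padic_abs p) a b"
proof -
  interpret rat_abs_value "padic_abs p" by (rule rat_abs_value_padic[OF p(1)])
  obtain f :: "nat \<Rightarrow> int" where f: "\<And>n. int p ^ Suc n dvd (f n)\<^sup>2 - w"
    "\<And>n. int p ^ Suc n dvd f (Suc n) - f n"
    using hensel_square_root_sequence[of "int p" u0 w] p u0 r by auto
  let ?Q = "\<lambda>n. q0 + of_int (f n) *s q1"
  have nn: "\<exists>j. \<not> abs_null (padic_abs p) (\<lambda>n. ?Q n $ j)"
  proof (rule ccontr)
    assume "\<not> ?thesis"
    then have *: "abs_null (padic_abs p) (\<lambda>n. ?Q n $ j * c)" for j c
      by (intro abs_null_mult_Cauchy) (simp_all del: vector_add_component)
    have "abs_null (padic_abs p) (\<lambda>n. ?Q n $ 1 * e $ 1 - ?Q n $ 2 * (a * e $ 2) - ?Q n $ 3 * (b * e $ 3)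
        + ?Q n $ 4 * (a * b * e $ 4))"
      by (intro abs_null_add abs_null_diff *)
    moreover have "?Q n $ 1 * e $ 1 - ?Q n $ 2 * (a * e $ 2) - ?Q n $ 3 * (b * e $ 3)
        + ?Q n $ 4 * (a * b * e $ 4) = qip a b q0 e" for n
    proof -
      have "?Q n $ 1 * e $ 1 - ?Q n $ 2 * (a * e $ 2) - ?Q n $ 3 * (b * e $ 3)
        + ?Q n $ 4 * (a * b * e $ 4) = qip a b (?Q n) e"
        by (simp only: qip_def mult_ac)
      then show ?thesis using e by (simp add: qip_linear)
    qed
    ultimately show False using e by (simp only: abs_null_const_iff)
  qed
  then obtain j where j: "\<not> abs_null (padic_abs p) (\<lambda>n. ?Q n $ j)" by blast
  show ?thesis
  proof (rule not_ramified_at_if_null_norm[OF _ _ j])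
    show "abs_Cauchy (padic_abs p) (\<lambda>n. ?Q n $ i)" for i
      using abs_Cauchy_add[OF abs_Cauchy_const[of "q0 $ i"]
          abs_Cauchy_mult_const[OF padic_Cauchy_if_dvd[OF p(1) f(2)], of "q1 $ i"]] by simp
    show "abs_null (padic_abs p) (\<lambda>n. qnr a b (?Q n))"
      unfolding N by (rule padic_null_if_dvd[OF p(1)]) (use f(1) in \<open>simp add: dvd_mult\<close>)
  qed
qed

text \<open>
  The trace zero elements \<open>x\<close> and \<open>e = A y - s x\<close> are orthogonal, of norms \<open>A\<close> and \<open>A n\<close>
  where \<open>n = A C - s\<^sup>2\<close>.  If \<open>p\<close> divides neither, then \<open>P\<^sup>2 + A X\<^sup>2 + A n\<close> has a zero modulo \<open>p\<close>,
  which lifts to a \<open>p\<close>-adic quaternion \<open>P + X x + e\<close> of norm zero.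
\<close>

lemma ramified_dvd_gram_aux:
  fixes A C s :: int
  assumes p: "prime p" "p > 2" and ram: "ramified_at (padic_abs p) a b"
    and x: "x $ 1 = 0" "qnr a b x = of_int A" and y: "y $ 1 = 0" "qnr a b y = of_int C"
    and s: "qip a b x y = of_int s" and A: "\<not> int p dvd A"
  shows "int p dvd A * C - s\<^sup>2"
proof (rule ccontr)
  define n where "n = A * C - s\<^sup>2"
  assume "\<not> ?thesis"
  then have n: "\<not> int p dvd n" by (simp add: n_def)
  have pp: "prime (int p)" "int p > 2" using p by auto
  have An: "\<not> int p dvd A * n" using A n pp prime_dvd_mult_iff by blast
  define e where "e = of_int A *s y - of_int s *s x"
  have ip: "qip a b qone qone = 1" "qip a b qone x = 0" "qip a b x qone = 0"
    "qip a b qone y = 0" "qip a b y qone = 0" "qip a b x x = of_int A" "qip a b y y = of_int C"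
    "qip a b x y = of_int s" "qip a b y x = of_int s"
    using x y s by (simp_all add: qnr_eq_qip qip_commute[of _ _ y x])
       (simp_all add: qip_def qone_def)
  have ipe: "qip a b qone e = 0" "qip a b e qone = 0" "qip a b x e = 0" "qip a b e x = 0"
    "qip a b e e = of_int (A * n)"
    by (simp_all add: e_def qip_linear ip n_def power2_eq_square algebra_simps)
  obtain P X where PX: "int p dvd P\<^sup>2 + A * X\<^sup>2 - (- (A * n))"
    using prime_quadratic_form_represents[OF pp A] by blast
  have "\<not> ramified_at (padic_abs p) a b"
  proof (cases "int p dvd P")
    case False
    \<comment> \<open>Here the scalar coefficient \<open>P\<close> is a unit modulo \<open>p\<close>
      and can be lifted.\<close>
    show ?thesis
    proof (rule not_ramified_at_if_isotropic_mod[OF p False, of "- A * X\<^sup>2 - A * n" a b "of_int X *s x + e" qone 1 e])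
      show "int p dvd P\<^sup>2 - (- A * X\<^sup>2 - A * n)" using PX by (simp add: algebra_simps)
      show "qnr a b (of_int X *s x + e + of_int u *s qone) = of_int (1 * (u\<^sup>2 - (- A * X\<^sup>2 - A * n)))" for u
        by (simp add: qnr_eq_qip qip_linear ip ipe power2_eq_square algebra_simps)
      show "qip a b qone e = 0" by (rule ipe)
      show "qip a b (of_int X *s x + e) e \<noteq> 0"
        using An by (auto simp: qip_linear ipe)
    qed
  next
    case True
    then have "int p dvd P\<^sup>2" by (simp add: power2_eq_square)
    then have "\<not> int p dvd X"
      using PX An by (metis (no_types, lifting) dvd_add_right_iff dvd_mult dvd_power dvd_trans diff_minus_eq_add zero_less_numeral)
    then have AX: "\<not> int p dvd A * X" using A pp prime_dvd_mult_iff by blast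
    \<comment> \<open>Now the coefficient of \<open>x\<close> is lifted. Scaling the quaternion by
      \<open>A\<close> brings the norm into the form \<open>A (u^2 - w)\<close> with integral
      \<open>w\<close> and approximate root \<open>A * X\<close>.\<close>
    show ?thesis
    proof (rule not_ramified_at_if_isotropic_mod[OF p AX, of "- A * P\<^sup>2 - A\<^sup>2 * n" a b "of_int (A * P) *s qone + of_int A *s e" x A e])
      have "(A * X)\<^sup>2 - (- A * P\<^sup>2 - A\<^sup>2 * n) = A * (P\<^sup>2 + A * X\<^sup>2 - (- (A * n)))"
        by (simp add: power2_eq_square algebra_simps)
      then show "int p dvd (A * X)\<^sup>2 - (- A * P\<^sup>2 - A\<^sup>2 * n)" using PX by (metis dvd_mult)
      show "qnr a b (of_int (A * P) *s qone + of_int A *s e + of_int u *s x) = of_int (A * (u\<^sup>2 - (- A * P\<^sup>2 - A\<^sup>2 * n)))" for u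
        by (simp add: qnr_eq_qip qip_linear ip ipe power2_eq_square algebra_simps)
      show "qip a b x e = 0" by (rule ipe)
      show "qip a b (of_int (A * P) *s qone + of_int A *s e) e \<noteq> 0"
        using An A by (auto simp: qip_linear ipe)
    qed
  qed
  then show False using ram by blast
qed

text \<open>By symmetry one norm prime to \<open>p\<close> is enough. If \<open>p\<close> divides
  both norms but not \<open>s\<close>, then \<open>x + y\<close> has norm congruent to
  \<open>2 s\<close>, and its Gram determinant with \<open>y\<close> is the old one.\<close>

lemma ramified_dvd_gram:
  fixes A C s :: int
  assumes p: "prime p" "p > 2" and ram: "ramified_at (padic_abs p) a b"
    and x: "x $ 1 = 0" "qnr a b x = of_int A" and y: "y $ 1 = 0" "qnr a b y = of_int C"
    and s: "qip a b x y = of_int s"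
  shows "int p dvd A * C - s\<^sup>2"
proof -
  have pp: "prime (int p)" using p by auto
  consider "\<not> int p dvd A" | "\<not> int p dvd C" | "int p dvd A" "int p dvd C" "\<not> int p dvd s"
    | "int p dvd A" "int p dvd s" by blast
  then show ?thesis
  proof cases
    case 1
    then show ?thesis by (intro ramified_dvd_gram_aux[OF p ram x y s])
  next
    case 2
    have "qip a b y x = of_int s" using s by (simp add: qip_commute)
    from ramified_dvd_gram_aux[OF p ram y x this 2] show ?thesis by (simp add: mult.commute)
  next
    case 3
    have ip: "qip a b x x = of_int A" "qip a b y y = of_int C" "qip a b y x = of_int s"
      using x y s by (simp_all add: qnr_eq_qip qip_commute[of _ _ y x])
    have "\<not> int p dvd 2" using p by (auto dest: zdvd_imp_le)
    then have "\<not> int p dvd 2 * s" using 3 pp prime_dvd_mult_iff by blast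
    then have "\<not> int p dvd A + C + 2 * s" using 3 by (meson dvd_add dvd_add_right_iff)
    moreover have "(x + y) $ 1 = 0" using x y by simp
    moreover have "qnr a b (x + y) = of_int (A + C + 2 * s)"
      using ip s by (simp add: qnr_eq_qip qip_linear)
    moreover have "qip a b (x + y) y = of_int (s + C)" using ip s by (simp add: qip_linear)
    ultimately have "int p dvd (A + C + 2 * s) * C - (s + C)\<^sup>2"
      using ramified_dvd_gram_aux[OF p ram _ _ y, of "x + y" "A + C + 2 * s" "s + C"] by blast
    then show ?thesis by (simp add: power2_eq_square algebra_simps)
  next
    case 4
    then show ?thesis by (simp add: power2_eq_square)
  qed
qed

subsection \<open>Integrality in orders\<close>

lemma rat_fraction:
  fixes r :: rat
  obtains m d :: int where "r = of_int m / of_int d" "d > 0" "coprime m d"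
  using quotient_of_div quotient_of_denom_pos quotient_of_coprime by (cases "quotient_of r") blast

lemma rat_square_Ints_imp_Ints:
  fixes r :: rat assumes "r\<^sup>2 \<in> \<int>" shows "r \<in> \<int>"
proof -
  obtain m d where r: "r = of_int m / of_int d" and d: "d > 0" and co: "coprime m d"
    by (rule rat_fraction)
  obtain k where k: "r\<^sup>2 = of_int k" using assms by (auto elim: Ints_cases)
  have "of_int (m\<^sup>2) = (of_int (k * d\<^sup>2) :: rat)"
    using k d by (simp add: r power_divide field_simps)
  then have "d\<^sup>2 dvd m\<^sup>2" by (simp only: of_int_eq_iff) simp
  then have "d dvd m" by simp
  then have "d = 1" using co d by (metis coprime_common_divisor dvd_refl zdvd1_eq abs_of_pos)
  then show ?thesis by (simp add: r)
qed

text \<open>If \<open>d\<close> is the reduced denominator, every \<open>d ^ n\<close> divides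
  \<open>K\<close>, which is impossible for \<open>d\<close> at least 2. This replaces the usual
  argument through integral elements.\<close>

lemma rat_Ints_if_powers_bounded_denominator:
  fixes r :: rat and K :: int
  assumes K: "K \<noteq> 0" and pw: "\<And>n. of_int K * r ^ n \<in> \<int>"
  shows "r \<in> \<int>"
proof -
  obtain m d where r: "r = of_int m / of_int d" and d: "d > 0" and co: "coprime m d"
    by (rule rat_fraction)
  have dv: "d ^ n dvd K" for n
  proof -
    obtain k where k: "of_int K * r ^ n = of_int k" using pw[of n] by (auto elim: Ints_cases)
    have "of_int (K * m ^ n) = (of_int (k * d ^ n) :: rat)"
      using k d by (simp add: r power_divide field_simps)
    then have "d ^ n dvd K * m ^ n" by (simp only: of_int_eq_iff) simp
    moreover have "coprime (d ^ n) (m ^ n)" using co by (simp add: coprime_commute)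
    ultimately show ?thesis by (simp add: coprime_dvd_mult_left_iff)
  qed
  have "d = 1"
  proof (rule ccontr)
    assume "d \<noteq> 1"
    then have d2: "2 \<le> d" using d by simp
    have "\<bar>K\<bar> < 2 ^ nat \<bar>K\<bar>"
      using of_nat_less_two_power[of "nat \<bar>K\<bar>", where 'a = int] by simp
    also have "\<dots> \<le> d ^ nat \<bar>K\<bar>" using d2 by (intro power_mono) auto
    also have "\<dots> \<le> \<bar>K\<bar>" using dvd_imp_le_int[OF K dv[of "nat \<bar>K\<bar>"]] d by simp
    finally show False by simp
  qed
  then show ?thesis by (simp add: r)
qed

lemma finite_common_denominator:
  fixes S :: "rat set" assumes "finite S"
  shows "\<exists>K::int. K \<noteq> 0 \<and> (\<forall>r\<in>S. of_int K * r \<in> \<int>)"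
  using assms
proof induction
  case (insert r S)
  then obtain K :: int where K: "K \<noteq> 0" "\<And>s. s \<in> S \<Longrightarrow> of_int K * s \<in> \<int>" by blast
  obtain m d where r: "r = of_int m / of_int d" "d > 0" by (rule rat_fraction)
  have "of_int (K * d) * r = of_int (K * m)" using r by simp
  then have "of_int (K * d) * r \<in> \<int>" by (metis Ints_of_int)
  moreover have "of_int (K * d) * s \<in> \<int>" if "s \<in> S" for s
    using Ints_mult[OF Ints_of_int[of d] K(2)[OF that]] by (simp add: mult_ac)
  ultimately show ?case using K r by (intro exI[of _ "K * d"]) auto
qed (auto intro: exI[of _ 1])

lemma lattice_common_denominator:
  assumes "is_lattice n R"
  shows "\<exists>K::int. K \<noteq> 0 \<and> (\<forall>u\<in>R. \<forall>i. of_int K * u $ i \<in> \<int>)"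
proof -
  obtain v where R: "R = {(\<Sum>i<n. rat_of_int (c i) *s v i) | c. True}"
    using assms by (auto simp: is_lattice_def lattice_basis_def)
  have "finite ((\<lambda>(j, i). v j $ i) ` ({..<n} \<times> (UNIV :: 4 set)))" by simp
  from finite_common_denominator[OF this] obtain K :: int
    where K: "K \<noteq> 0" "\<And>j i. j < n \<Longrightarrow> of_int K * v j $ i \<in> \<int>" by auto
  have "of_int K * (\<Sum>j<n. rat_of_int (c j) *s v j) $ i \<in> \<int>" for c i
  proof -
    have "of_int K * (\<Sum>j<n. rat_of_int (c j) *s v j) $ i = (\<Sum>j<n. of_int (c j) * (of_int K * v j $ i))"
      by (simp add: sum_distrib_left mult_ac)
    also have "\<dots> \<in> \<int>" by (intro Ints_sum Ints_mult K) auto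
    finally show ?thesis .
  qed
  then show ?thesis using K(1) unfolding R by blast
qed

section \<open>Trace zero parts and their Gram determinants\<close>

text \<open>Equals \<open>u - qconj u\<close>; the image of an order under this map is its trace
  lattice.\<close>

definition qpure :: "quat \<Rightarrow> quat" where
  "qpure u = 2 *s u - qtr u *s qone"

lemma qpure_1 [simp]: "qpure u $ 1 = 0"
  by (simp add: qpure_def qtr_def qconj_def qone_def)

lemma qpure_add: "qpure (u + w) = qpure u + qpure w"
  and qpure_diff: "qpure (u - w) = qpure u - qpure w"
  and qpure_uminus: "qpure (- u) = - qpure u"
  and qpure_scale: "qpure (r *s u) = r *s qpure u"
  by (simp_all add: vec_eq_iff forall_4 qpure_def qtr_def qconj_def qone_def algebra_simps)

text \<open>Polarized form of \<open>Nr(2u - Tr u) = 4 Nr(u) - Tr(u)^2\<close>, the source of all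
  congruences modulo 4 below.\<close>

lemma qip_qpure: "qip a b (qpure u) (qpure w) = 4 * qip a b u w - qtr u * qtr w"
  by (simp add: qip_def qpure_def qtr_def qconj_def qone_def algebra_simps)

definition qgram :: "rat \<Rightarrow> rat \<Rightarrow> quat \<Rightarrow> quat \<Rightarrow> rat" where
  "qgram a b x y = qnr a b x * qnr a b y - (qip a b x y)\<^sup>2"

text \<open>Equal to \<open>(x y - y x) / 2\<close> for \<open>x\<close> and \<open>y\<close> of trace zero.\<close>

definition qcross :: "rat \<Rightarrow> rat \<Rightarrow> quat \<Rightarrow> quat \<Rightarrow> quat" where
  "qcross a b x y = qmult a b x y + qip a b x y *s qone"

text \<open>The right-hand side is the Gram determinant of \<open>x\<close>, \<open>y\<close>,
  \<open>v\<close>; the left-hand side is the square of their scalar triple product.\<close>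

lemma qcross_triple_square:
  assumes "x $ 1 = 0" "y $ 1 = 0" "v $ 1 = 0"
  shows "(qip a b v (qcross a b x y))\<^sup>2 =
    qip a b x x * qip a b y y * qip a b v v + 2 * qip a b x y * qip a b x v * qip a b y v
    - qip a b x x * (qip a b y v)\<^sup>2 - qip a b y y * (qip a b x v)\<^sup>2 - qip a b v v * (qip a b x y)\<^sup>2"
  using assms by (simp add: qcross_def qip_def qmult_def qone_def power2_eq_square algebra_simps)

text \<open>\<open>qcross\<close> is orthogonal to \<open>x\<close> and \<open>y\<close> and has
  norm \<open>qgram a b x y\<close>; the other two coefficients come from Cramer's rule. Multiplying
  by \<open>qgram\<close> avoids denominators.\<close>

lemma qcross_expansion:
  assumes "x $ 1 = 0" "y $ 1 = 0" "v $ 1 = 0"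
  shows "qgram a b x y *s v = qip a b v (qcross a b x y) *s qcross a b x y
    + (qnr a b y * qip a b v x - qip a b x y * qip a b v y) *s x
    + (qnr a b x * qip a b v y - qip a b x y * qip a b v x) *s y"
  using assms
  by (simp add: vec_eq_iff forall_4 qcross_def qgram_def qnr_eq_qip qip_def qmult_def qone_def
      power2_eq_square algebra_simps)

text \<open>Normalizes the component along the normal: for Gram determinant \<open>4p\<close> the
  product \<open>u w\<close> contributes exactly \<open>2p\<close>.\<close>

lemma qcross_qpure_qmult:
  "qip a b (qpure (qmult a b u w)) (qcross a b (qpure u) (qpure w)) = qgram a b (qpure u) (qpure w) / 2"
  by (simp add: qcross_def qgram_def qnr_eq_qip qip_def qmult_def qone_def qpure_def qtr_def qconj_def
      power2_eq_square algebra_simps)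

text \<open>The hypotheses are the principal 2x2 minors and minors for one vector with the sum of
  the other two. Polarization yields twice the remaining minors, so \<open>p\<close> divides the
  whole adjugate of the 3x3 Gram matrix.\<close>

lemma dvd_square_gram_det:
  fixes p A C E s f h :: int
  assumes p: "prime p" "p > 2"
    and d: "p dvd A * C - s\<^sup>2" "p dvd A * E - f\<^sup>2" "p dvd C * E - h\<^sup>2"
      "p dvd A * (C + E + 2 * h) - (s + f)\<^sup>2" "p dvd C * (A + E + 2 * f) - (s + h)\<^sup>2"
      "p dvd E * (A + C + 2 * s) - (f + h)\<^sup>2"
  shows "p\<^sup>2 dvd A * C * E + 2 * s * f * h - A * h\<^sup>2 - C * f\<^sup>2 - E * s\<^sup>2"
proof -
  define D where "D = A * C * E + 2 * s * f * h - A * h\<^sup>2 - C * f\<^sup>2 - E * s\<^sup>2"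
  have n2: "\<not> p dvd 2" using p by (auto dest: zdvd_imp_le)
  have off: "p dvd z" if "p dvd 2 * z" for z using that n2 p prime_dvd_mult_iff by blast
  have "p dvd 2 * (A * h - s * f)"
    using dvd_diff[OF dvd_diff[OF d(4) d(1)] d(2)] by (simp add: power2_eq_square algebra_simps)
  then have m23: "p dvd A * h - s * f" by (rule off)
  have "p dvd 2 * (C * f - s * h)"
    using dvd_diff[OF dvd_diff[OF d(5) d(1)] d(3)] by (simp add: power2_eq_square algebra_simps)
  then have m13: "p dvd C * f - s * h" by (rule off)
  have "p dvd 2 * (E * s - f * h)"
    using dvd_diff[OF dvd_diff[OF d(6) d(2)] d(3)] by (simp add: power2_eq_square algebra_simps)
  then have m12: "p dvd E * s - f * h" by (rule off)
  have D1: "D = A * (C * E - h\<^sup>2) - s * (E * s - f * h) - f * (C * f - s * h)"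
    by (simp add: D_def power2_eq_square algebra_simps)
  have "p dvd D" unfolding D1 by (intro dvd_diff dvd_mult m12 m13 d)
  then obtain D' where D': "D = p * D'" by blast
  obtain m11 m22 m33 k12 k13 k23 where m: "C * E - h\<^sup>2 = p * m11" "A * E - f\<^sup>2 = p * m22"
    "A * C - s\<^sup>2 = p * m33" "A * h - s * f = p * k23" "C * f - s * h = p * k13" "E * s - f * h = p * k12"
    using d(1-3) m12 m13 m23 by (elim dvdE) blast
  \<comment> \<open>The determinant of the adjugate is the square of the determinant; hence
    \<open>p^3\<close> divides \<open>D^2\<close>.\<close>
  have "D\<^sup>2 = (C * E - h\<^sup>2) * (A * E - f\<^sup>2) * (A * C - s\<^sup>2) - 2 * (A * h - s * f) * (C * f - s * h) * (E * s - f * h)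
      - (C * E - h\<^sup>2) * (A * h - s * f)\<^sup>2 - (A * E - f\<^sup>2) * (C * f - s * h)\<^sup>2 - (A * C - s\<^sup>2) * (E * s - f * h)\<^sup>2"
    by (simp add: D_def power2_eq_square algebra_simps)
  also have "\<dots> = p\<^sup>2 * (p * (m11 * m22 * m33 - 2 * k23 * k13 * k12 - m11 * k23\<^sup>2 - m22 * k13\<^sup>2 - m33 * k12\<^sup>2))"
    unfolding m by (simp add: power2_eq_square algebra_simps)
  finally have "p\<^sup>2 * D'\<^sup>2 = p\<^sup>2 * (p * (m11 * m22 * m33 - 2 * k23 * k13 * k12 - m11 * k23\<^sup>2 - m22 * k13\<^sup>2 - m33 * k12\<^sup>2))"
    by (simp add: D' power_mult_distrib)
  then have "D'\<^sup>2 = p * (m11 * m22 * m33 - 2 * k23 * k13 * k12 - m11 * k23\<^sup>2 - m22 * k13\<^sup>2 - m33 * k12\<^sup>2)"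
    using p by simp
  then have "p dvd D'" using p prime_dvd_power by (metis dvd_triv_left)
  then show ?thesis using D' unfolding D_def by (simp add: power2_eq_square)
qed

section \<open>Integrality and discriminants in one order\<close>

locale ramified_order =
  fixes p :: nat and a b :: rat and R :: "quat set"
  assumes prime_p: "prime p" and p_gt_2: "p > 2"
    and neg: "a < 0" "b < 0"
    and ram: "ramified_at (padic_abs p) a b"
    and order: "is_order a b R"
begin

lemma one_mem: "qone \<in> R" and diff_mem: "u \<in> R \<Longrightarrow> w \<in> R \<Longrightarrow> u - w \<in> R"
  and mult_mem: "u \<in> R \<Longrightarrow> w \<in> R \<Longrightarrow> qmult a b u w \<in> R"
  using order by (auto simp: is_order_def)

lemma zero_mem: "0 \<in> R"
  using diff_mem[OF one_mem one_mem] by simp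

lemma minus_mem: "u \<in> R \<Longrightarrow> - u \<in> R"
  using diff_mem[OF zero_mem] by simp

lemma add_mem: "u \<in> R \<Longrightarrow> w \<in> R \<Longrightarrow> u + w \<in> R"
  using diff_mem[OF _ minus_mem] by simp

lemma int_scale_mem: "u \<in> R \<Longrightarrow> rat_of_int k *s u \<in> R"
proof (induction k rule: int_induct[where k = 0])
  case base
  then show ?case using zero_mem by simp
next
  case (step1 i)
  then show ?case using add_mem[of "of_int i *s u" u] by (simp add: vector_sadd_rdistrib)
next
  case (step2 i)
  then show ?case using diff_mem[of "of_int i *s u" u] by (simp add: vec.scale_left_diff_distrib)
qed

text \<open>The powers of \<open>u\<close> stay in \<open>R\<close>, where norms have a common
  denominator, and their norms are the powers of \<open>qnr a b u\<close>.\<close>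

lemma qnr_Ints: assumes u: "u \<in> R" shows "qnr a b u \<in> \<int>"
proof -
  obtain K :: int where K: "K \<noteq> 0" "\<And>w i. w \<in> R \<Longrightarrow> of_int K * w $ i \<in> \<int>"
    using lattice_common_denominator[of 4 R] order by (auto simp: is_order_def)
  obtain M :: int where M: "M \<noteq> 0" "of_int M * a \<in> \<int>" "of_int M * b \<in> \<int>" "of_int M * (a * b) \<in> \<int>"
    using finite_common_denominator[of "{a, b, a * b}"] by auto
  have bd: "of_int (M * K\<^sup>2) * qnr a b w \<in> \<int>" if w: "w \<in> R" for w
  proof -
    note i = Ints_power[OF K(2)[OF w]]
    have "of_int (M * K\<^sup>2) * qnr a b w = of_int M * (of_int K * w $ 1)\<^sup>2 - (of_int M * a) * (of_int K * w $ 2)\<^sup>2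
      - (of_int M * b) * (of_int K * w $ 3)\<^sup>2 + (of_int M * (a * b)) * (of_int K * w $ 4)\<^sup>2"
      by (simp add: qnr_eq_qip qip_def power2_eq_square algebra_simps)
    also have "\<dots> \<in> \<int>"
      by (rule Ints_add[OF Ints_diff[OF Ints_diff[OF Ints_mult[OF Ints_of_int i] Ints_mult[OF M(2) i]]
            Ints_mult[OF M(3) i]] Ints_mult[OF M(4) i]])
    finally show ?thesis .
  qed
  have pw: "\<exists>w\<in>R. qnr a b w = qnr a b u ^ n" for n
  proof (induction n)
    case 0
    then show ?case using one_mem by (auto simp: qnr_eq_qip qip_def qone_def intro!: bexI[of _ qone])
  next
    case (Suc n)
    then obtain w where "w \<in> R" "qnr a b w = qnr a b u ^ n" by blast
    then show ?case using mult_mem[OF u] by (auto simp: qnr_qmult intro!: bexI[of _ "qmult a b u w"])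
  qed
  show ?thesis
  proof (rule rat_Ints_if_powers_bounded_denominator)
    show "M * K\<^sup>2 \<noteq> 0" using K M by simp
    show "of_int (M * K\<^sup>2) * qnr a b u ^ n \<in> \<int>" for n using pw[of n] bd by metis
  qed
qed

lemma qip_double_Ints:
  assumes "u \<in> R" "w \<in> R" shows "2 * qip a b u w \<in> \<int>"
proof -
  have "2 * qip a b u w = qnr a b (u + w) - qnr a b u - qnr a b w"
    by (simp add: qnr_eq_qip qip_linear qip_commute[of a b w u])
  then show ?thesis using assms qnr_Ints add_mem by simp
qed

lemma qtr_Ints: assumes "u \<in> R" shows "qtr u \<in> \<int>"
proof -
  have "qtr u = 2 * qip a b u qone" by (simp add: qtr_def qconj_def qip_def qone_def)
  then show ?thesis using qip_double_Ints[OF assms one_mem] by simp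
qed

lemma qpure_qip_Ints:
  assumes "u \<in> R" "w \<in> R" shows "qip a b (qpure u) (qpure w) \<in> \<int>"
proof -
  have "qip a b (qpure u) (qpure w) = 2 * (2 * qip a b u w) - qtr u * qtr w" by (simp add: qip_qpure)
  also have "\<dots> \<in> \<int>"
    by (intro Ints_diff Ints_mult qip_double_Ints qtr_Ints assms) auto
  finally show ?thesis .
qed

lemma odd_prime: "prime (int p)" "int p > 2" "coprime (int p) 4"
proof -
  show p: "prime (int p)" "int p > 2" using prime_p p_gt_2 by auto
  have "odd (int p)" using prime_odd_nat[OF prime_p p_gt_2] by simp
  then have c: "coprime (int p) 2" by simp
  have "coprime (int p) (2 ^ 2)" using c by (intro coprime_power_right_iff[THEN iffD2]) simp
  then show "coprime (int p) 4" by simp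
qed

lemma dvd_qgram:
  assumes "u \<in> R" "w \<in> R" 
    and A: "qnr a b (qpure u) = of_int A" and C: "qnr a b (qpure w) = of_int C"
    and s: "qip a b (qpure u) (qpure w) = of_int s"
  shows "int p dvd A * C - s\<^sup>2"
  by (rule ramified_dvd_gram[OF prime_p p_gt_2 ram _ A _ C s]) simp_all

text \<open>The entries \<open>4 A - t^2\<close>, \<open>4 C - r^2\<close> and
  \<open>2 s - t r\<close> give the factor 4, ramification gives \<open>p\<close>, and these are
  coprime because \<open>p\<close> is odd.\<close>

lemma qgram_multiple:
  assumes u: "u \<in> R" and w: "w \<in> R"
  obtains m :: int where "qgram a b (qpure u) (qpure w) = 4 * of_nat p * of_int m"
proof -
  obtain t where t: "qtr u = of_int t" using qtr_Ints[OF u] by (auto elim: Ints_cases)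
  obtain r where r: "qtr w = of_int r" using qtr_Ints[OF w] by (auto elim: Ints_cases)
  obtain A where A: "qnr a b u = of_int A" using qnr_Ints[OF u] by (auto elim: Ints_cases)
  obtain C where C: "qnr a b w = of_int C" using qnr_Ints[OF w] by (auto elim: Ints_cases)
  obtain s where s: "2 * qip a b u w = of_int s" using qip_double_Ints[OF u w] by (auto elim: Ints_cases)
  have A': "qnr a b (qpure u) = of_int (4 * A - t\<^sup>2)"
    using A t by (simp add: qnr_eq_qip qip_qpure power2_eq_square)
  have C': "qnr a b (qpure w) = of_int (4 * C - r\<^sup>2)"
    using C r by (simp add: qnr_eq_qip qip_qpure power2_eq_square)
  have s': "qip a b (qpure u) (qpure w) = of_int (2 * s - t * r)"
    using s t r by (simp add: qip_qpure flip: s)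
  let ?n = "(4 * A - t\<^sup>2) * (4 * C - r\<^sup>2) - (2 * s - t * r)\<^sup>2"
  have "?n = 4 * (4 * A * C - A * r\<^sup>2 - C * t\<^sup>2 - s\<^sup>2 + s * t * r)"
    by (simp add: power2_eq_square algebra_simps)
  then have "4 dvd ?n" by (metis dvd_triv_left)
  moreover have "int p dvd ?n" by (rule dvd_qgram[OF u w A' C' s'])
  ultimately have "int p * 4 dvd ?n" using odd_prime(3) by (intro divides_mult)
  then obtain m where "?n = int p * 4 * m" by blast
  moreover have "qgram a b (qpure u) (qpure w) = of_int ?n"
    by (simp only: qgram_def A' C' s' of_int_diff of_int_mult of_int_power)
  ultimately have "qgram a b (qpure u) (qpure w) = 4 * of_nat p * of_int m"
    by (simp only:) simp
  then show ?thesis by (rule that)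
qed

lemma gram_det_multiple:
  assumes u: "u \<in> R" and w: "w \<in> R" and g: "g \<in> R"
  obtains m :: int where
    "(qip a b (qpure g) (qcross a b (qpure u) (qpure w)))\<^sup>2 = 4 * (of_nat p)\<^sup>2 * of_int m"
proof -
  obtain t1 where t1: "qtr u = of_int t1" using qtr_Ints[OF u] by (auto elim: Ints_cases)
  obtain t2 where t2: "qtr w = of_int t2" using qtr_Ints[OF w] by (auto elim: Ints_cases)
  obtain t3 where t3: "qtr g = of_int t3" using qtr_Ints[OF g] by (auto elim: Ints_cases)
  obtain n1 where n1: "qnr a b u = of_int n1" using qnr_Ints[OF u] by (auto elim: Ints_cases)
  obtain n2 where n2: "qnr a b w = of_int n2" using qnr_Ints[OF w] by (auto elim: Ints_cases)
  obtain n3 where n3: "qnr a b g = of_int n3" using qnr_Ints[OF g] by (auto elim: Ints_cases)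
  obtain m12 where m12: "2 * qip a b u w = of_int m12" using qip_double_Ints[OF u w] by (auto elim: Ints_cases)
  obtain m13 where m13: "2 * qip a b u g = of_int m13" using qip_double_Ints[OF u g] by (auto elim: Ints_cases)
  obtain m23 where m23: "2 * qip a b w g = of_int m23" using qip_double_Ints[OF w g] by (auto elim: Ints_cases)
  define A where "A = 4 * n1 - t1\<^sup>2"
  define C where "C = 4 * n2 - t2\<^sup>2"
  define E where "E = 4 * n3 - t3\<^sup>2"
  define s where "s = 2 * m12 - t1 * t2"
  define f where "f = 2 * m13 - t1 * t3"
  define h where "h = 2 * m23 - t2 * t3"
  have A: "qip a b (qpure u) (qpure u) = of_int A"
    using n1 t1 by (simp add: A_def qnr_eq_qip qip_qpure power2_eq_square)
  have C: "qip a b (qpure w) (qpure w) = of_int C"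
    using n2 t2 by (simp add: C_def qnr_eq_qip qip_qpure power2_eq_square)
  have E: "qip a b (qpure g) (qpure g) = of_int E"
    using n3 t3 by (simp add: E_def qnr_eq_qip qip_qpure power2_eq_square)
  have s: "qip a b (qpure u) (qpure w) = of_int s"
    using m12 t1 t2 by (simp add: s_def qip_qpure flip: m12)
  have f: "qip a b (qpure u) (qpure g) = of_int f"
    using m13 t1 t3 by (simp add: f_def qip_qpure flip: m13)
  have h: "qip a b (qpure w) (qpure g) = of_int h"
    using m23 t2 t3 by (simp add: h_def qip_qpure flip: m23)
  note comm = s[unfolded qip_commute[of a b "qpure u" "qpure w"]]
    f[unfolded qip_commute[of a b "qpure u" "qpure g"]]
    h[unfolded qip_commute[of a b "qpure w" "qpure g"]]
  note ips = A C E s f h comm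
  let ?D = "A * C * E + 2 * s * f * h - A * h\<^sup>2 - C * f\<^sup>2 - E * s\<^sup>2"
  have "(int p)\<^sup>2 dvd ?D"
  proof (rule dvd_square_gram_det[OF odd_prime(1,2)])
    show "int p dvd A * C - s\<^sup>2" by (rule dvd_qgram[OF u w]) (simp_all add: qnr_eq_qip ips)
    show "int p dvd A * E - f\<^sup>2" by (rule dvd_qgram[OF u g]) (simp_all add: qnr_eq_qip ips)
    show "int p dvd C * E - h\<^sup>2" by (rule dvd_qgram[OF w g]) (simp_all add: qnr_eq_qip ips)
    show "int p dvd A * (C + E + 2 * h) - (s + f)\<^sup>2"
      by (rule dvd_qgram[OF u add_mem[OF w g]]) (simp_all add: qnr_eq_qip qpure_add qip_linear ips)
    show "int p dvd C * (A + E + 2 * f) - (s + h)\<^sup>2"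
      by (rule dvd_qgram[OF w add_mem[OF u g]]) (simp_all add: qnr_eq_qip qpure_add qip_linear ips)
    show "int p dvd E * (A + C + 2 * s) - (f + h)\<^sup>2"
      by (rule dvd_qgram[OF g add_mem[OF u w]]) (simp_all add: qnr_eq_qip qpure_add qip_linear ips)
  qed
  moreover have "4 dvd ?D"
  proof -
    have "?D = 4 * (2 * (8 * n1 * n2 * n3 + 2 * m12 * m13 * m23 - 2 * n1 * m23\<^sup>2 - 2 * n2 * m13\<^sup>2 - 2 * n3 * m12\<^sup>2)
      - (t1\<^sup>2 * (4 * n2 * n3 - m23\<^sup>2) + t2\<^sup>2 * (4 * n1 * n3 - m13\<^sup>2) + t3\<^sup>2 * (4 * n1 * n2 - m12\<^sup>2)
         + 2 * t1 * t2 * (m13 * m23 - 2 * n3 * m12) + 2 * t1 * t3 * (m12 * m23 - 2 * n2 * m13)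
         + 2 * t2 * t3 * (m12 * m13 - 2 * n1 * m23)))"
      unfolding A_def C_def E_def s_def f_def h_def by (simp add: power2_eq_square algebra_simps)
    then show ?thesis by (metis dvd_triv_left)
  qed
  moreover have "coprime ((int p)\<^sup>2) 4" using odd_prime(3) by simp
  ultimately have "(int p)\<^sup>2 * 4 dvd ?D" by (intro divides_mult)
  then obtain m where m: "?D = (int p)\<^sup>2 * 4 * m" by blast
  have "(qip a b (qpure g) (qcross a b (qpure u) (qpure w)))\<^sup>2 = of_int ?D"
    by (subst qcross_triple_square) (simp_all add: ips)
  also have "\<dots> = 4 * (of_nat p)\<^sup>2 * of_int m" by (simp only: m) simp
  finally show ?thesis by (rule that)
qed

text \<open>
  Elementary form of the discriminant argument: the order generated by \<open>u\<close> and \<open>w\<close> has reduced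
  discriminant \<open>qgram / 4\<close>, and every order has reduced discriminant divisible by \<open>p\<close>.
\<close>

lemma order_eq_span:
  assumes u: "u \<in> R" and w: "w \<in> R" and gram: "qgram a b (qpure u) (qpure w) = 4 * of_nat p"
  shows "R = {of_int k0 *s qone + of_int k1 *s u + of_int k2 *s w + of_int k3 *s qmult a b u w
               | k0 k1 k2 k3. True}"
proof (intro equalityI subsetI)
  fix g assume g: "g \<in> R"
  have p0: "rat_of_nat p > 0" using p_gt_2 by simp
  define x where "x = qpure u"
  define y where "y = qpure w"
  define c where "c = qcross a b x y"
  obtain m :: int where "(qip a b (qpure g) c)\<^sup>2 = 4 * (of_nat p)\<^sup>2 * of_int m"
    using gram_det_multiple[OF u w g] unfolding c_def x_def y_def by blast
  \<comment> \<open>The divisor \<open>2p\<close> is the value of the same functional at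
    \<open>u w\<close>, so this quotient is the coordinate of \<open>g\<close> at
    \<open>u w\<close>.\<close>
  then have "(qip a b (qpure g) c / (2 * of_nat p))\<^sup>2 = of_int m"
    using p0 by (simp add: power_divide power_mult_distrib)
  then have "qip a b (qpure g) c / (2 * of_nat p) \<in> \<int>"
    using rat_square_Ints_imp_Ints Ints_of_int by metis
  then obtain k3 where k3: "qip a b (qpure g) c / (2 * of_nat p) = of_int k3" by (auto elim: Ints_cases)
  define d where "d = g - of_int k3 *s qmult a b u w"
  have d: "d \<in> R" unfolding d_def by (intro diff_mem int_scale_mem mult_mem g u w)
  define v where "v = qpure d"
  have "qip a b v c = 0"
    unfolding v_def d_def qpure_diff qpure_scale qip_linear
    unfolding c_def x_def y_def qcross_qpure_qmult gram
    using k3 p0 by (simp add: c_def x_def y_def field_simps)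
  define e f where "e = (qnr a b y * qip a b v x - qip a b x y * qip a b v y) / (4 * of_nat p)"
    and "f = (qnr a b x * qip a b v y - qip a b x y * qip a b v x) / (4 * of_nat p)"
  have "(4 * of_nat p) *s v = qip a b v c *s c
    + (qnr a b y * qip a b v x - qip a b x y * qip a b v y) *s x
    + (qnr a b x * qip a b v y - qip a b x y * qip a b v x) *s y"
    unfolding c_def gram[symmetric] x_def y_def v_def by (rule qcross_expansion) simp_all
  also have "\<dots> = (4 * of_nat p) *s (e *s x + f *s y)"
    using p0 \<open>qip a b v c = 0\<close> by (simp add: e_def f_def vec.scale_right_distrib)
  finally have v_eq: "v = e *s x + f *s y" using p0 by (simp only: vector_mul_lcancel) simp
  have gxy: "qnr a b x * qnr a b y - (qip a b x y)\<^sup>2 = 4 * of_nat p"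
    using gram by (simp add: qgram_def x_def y_def)
  \<comment> \<open>Both Gram determinants are multiples of \<open>4p\<close> and that of
    \<open>x\<close>, \<open>y\<close> is \<open>4p\<close> itself, so \<open>f^2\<close> is an
    integer; \<open>e\<close> is treated alike.\<close>
  have "qgram a b x v = f\<^sup>2 * (qnr a b x * qnr a b y - (qip a b x y)\<^sup>2)"
    by (simp add: v_eq qgram_def qnr_eq_qip qip_linear qip_commute[of a b y x] power2_eq_square algebra_simps)
  moreover obtain m1 :: int where "qgram a b x v = 4 * of_nat p * of_int m1"
    using qgram_multiple[OF u d] unfolding x_def v_def by blast
  ultimately have "f\<^sup>2 = of_int m1" using p0 gxy by simp
  then obtain k2 where k2: "f = of_int k2" by (metis rat_square_Ints_imp_Ints Ints_of_int Ints_cases)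
  have "qgram a b v y = e\<^sup>2 * (qnr a b x * qnr a b y - (qip a b x y)\<^sup>2)"
    by (simp add: v_eq qgram_def qnr_eq_qip qip_linear qip_commute[of a b y x] power2_eq_square algebra_simps)
  moreover obtain m2 :: int where "qgram a b v y = 4 * of_nat p * of_int m2"
    using qgram_multiple[OF d w] unfolding y_def v_def by blast
  ultimately have "e\<^sup>2 = of_int m2" using p0 gxy by simp
  then obtain k1 where k1: "e = of_int k1" by (metis rat_square_Ints_imp_Ints Ints_of_int Ints_cases)
  define r where "r = (qtr d - e * qtr u - f * qtr w) / 2"
  have rd: "d - of_int k1 *s u - of_int k2 *s w = r *s qone"
  proof (rule iffD2[OF vec_eq_iff], rule allI)
    fix i
    have "v $ i = e * x $ i + f * y $ i" using v_eq by simp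
    then have "2 * d $ i = qtr d * qone $ i + e * (2 * u $ i - qtr u * qone $ i) + f * (2 * w $ i - qtr w * qone $ i)"
      by (simp add: v_def x_def y_def qpure_def)
    then have "d $ i - e * u $ i - f * w $ i = r * qone $ i" by (simp add: r_def field_simps)
    then show "(d - of_int k1 *s u - of_int k2 *s w) $ i = (r *s qone) $ i" by (simp add: k1 k2)
  qed
  \<comment> \<open>What is left is a rational scalar in \<open>R\<close>, whose norm
    \<open>r^2\<close> is an integer.\<close>
  have "r *s qone \<in> R" unfolding rd[symmetric] by (intro diff_mem int_scale_mem d u w)
  from qnr_Ints[OF this] have "r\<^sup>2 \<in> \<int>" by (simp add: qnr_eq_qip qip_def qone_def power2_eq_square)
  then obtain k0 where "r = of_int k0" by (metis rat_square_Ints_imp_Ints Ints_cases)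
  then have "g = of_int k0 *s qone + of_int k1 *s u + of_int k2 *s w + of_int k3 *s qmult a b u w"
    using rd by (simp add: d_def algebra_simps)
  then show "g \<in> {of_int k0 *s qone + of_int k1 *s u + of_int k2 *s w + of_int k3 *s qmult a b u w
               | k0 k1 k2 k3. True}" by blast
next
  fix g assume "g \<in> {of_int k0 *s qone + of_int k1 *s u + of_int k2 *s w + of_int k3 *s qmult a b u w
               | k0 k1 k2 k3. True}"
  then show "g \<in> R" using u w by (auto intro!: add_mem int_scale_mem mult_mem one_mem)
qed

end

subsection \<open>Conjugating isometric pairs\<close>

lemma qnr_pos: assumes "a < 0" "b < 0" "u \<noteq> 0" shows "qnr a b u > 0"
proof -
  have "qnr a b u = (u$1)\<^sup>2 + (- a) * (u$2)\<^sup>2 + (- b) * (u$3)\<^sup>2 + (a * b) * (u$4)\<^sup>2"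
    by (simp add: qnr_eq_qip qip_def power2_eq_square)
  moreover have ab: "a * b > 0" using assms by (simp add: mult_neg_neg)
  have "(u$1)\<^sup>2 \<ge> 0" "(- a) * (u$2)\<^sup>2 \<ge> 0" "(- b) * (u$3)\<^sup>2 \<ge> 0" "(a * b) * (u$4)\<^sup>2 \<ge> 0"
    using assms ab mult_nonpos_nonneg[of a "(u$2)\<^sup>2"] mult_nonpos_nonneg[of b "(u$3)\<^sup>2"] by simp_all
  moreover have "(u$1)\<^sup>2 > 0 \<or> (- a) * (u$2)\<^sup>2 > 0 \<or> (- b) * (u$3)\<^sup>2 > 0 \<or> (a * b) * (u$4)\<^sup>2 > 0"
  proof -
    have "u$1 \<noteq> 0 \<or> u$2 \<noteq> 0 \<or> u$3 \<noteq> 0 \<or> u$4 \<noteq> 0" using assms by (auto simp: vec_eq_iff forall_4)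
    then show ?thesis using assms(1,2) ab by (auto simp: zero_less_mult_iff mult_less_0_iff)
  qed
  ultimately show ?thesis by linarith
qed

lemma qmult_pure_square:
  assumes "x $ 1 = 0" shows "qmult a b x x = - (qnr a b x *s qone)"
  using assms by (simp add: vec_eq_iff forall_4 qnr_eq_qip qip_def qmult_def qone_def)

lemma qmult_pure_anticommute:
  assumes "x $ 1 = 0" "y $ 1 = 0" "qip a b x y = 0" shows "qmult a b y x = - qmult a b x y"
  using assms by (simp add: vec_eq_iff forall_4 qip_def qmult_def qone_def algebra_simps)

text \<open>
  For every \<open>q\<close> the sum \<open>c q\<close> of \<open>e' q e\<^sup>-\<^sup>1\<close> over \<open>e = 1, x, y, xy\<close> and the corresponding
  \<open>e' = 1, x', y', x'y'\<close> (up to a scalar) intertwines; not all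
  \<open>c q\<close> vanish since \<open>\<Sum> c(e) e\<^sup>-\<^sup>1\<close> is a nonzero scalar.
\<close>

lemma intertwiner_exists:
  assumes nz: "A \<noteq> 0" "B \<noteq> 0"
    and x: "x $ 1 = 0" "qnr a b x = A" and x': "x' $ 1 = 0" "qnr a b x' = A"
    and y: "y $ 1 = 0" "qnr a b y = B" and y': "y' $ 1 = 0" "qnr a b y' = B"
    and xy: "qip a b x y = 0" and xy': "qip a b x' y' = 0"
  obtains c where "c \<noteq> 0" "qmult a b c x = qmult a b x' c" "qmult a b c y = qmult a b y' c"
proof -
  let ?m = "qmult a b"
  have sq: "?m x x = - (A *s qone)" "?m x' x' = - (A *s qone)" "?m y y = - (B *s qone)" "?m y' y' = - (B *s qone)"
    using x x' y y' by (simp_all add: qmult_pure_square)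
  have anti: "?m y x = - ?m x y" "?m y' x' = - ?m x' y'"
    using x x' y y' xy xy' qmult_pure_anticommute by blast+
  have sq': "?m x (?m x q) = - (A *s q)" "?m x' (?m x' q) = - (A *s q)"
    "?m y (?m y q) = - (B *s q)" "?m y' (?m y' q) = - (B *s q)" for q
    by (simp_all add: qmult_assoc[symmetric] sq qmult_linear)
  have anti': "?m y (?m x q) = - ?m x (?m y q)" "?m y' (?m x' q) = - ?m x' (?m y' q)" for q
    by (simp_all add: qmult_assoc[symmetric] anti qmult_linear)
  \<comment> \<open>Scaled by \<open>A * B\<close>; the inverses of \<open>x\<close>,
    \<open>y\<close>, \<open>xy\<close> are \<open>-x/A\<close>, \<open>-y/B\<close>,
    \<open>-xy/(AB)\<close>.\<close>
  define c where "c q = (A * B) *s q - B *s ?m x' (?m q x) - A *s ?m y' (?m q y) - ?m x' (?m y' (?m q (?m x y)))" for q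
  note rules = qmult_assoc qmult_linear sq sq' anti anti' 
  have cx: "?m (c q) x = ?m x' (c q)" and cy: "?m (c q) y = ?m y' (c q)" for q
    by (simp_all add: c_def rules vec_eq_iff algebra_simps)
  have "\<exists>q. c q \<noteq> 0"
  proof (rule ccontr)
    assume "\<not> ?thesis"
    then have c0: "c q = 0" for q by blast
    \<comment> \<open>Summing \<open>f z f^-1\<close> over \<open>f = 1, x, y, xy\<close>
      annihilates trace zero elements, so only the summand \<open>e = 1\<close> survives, with
      factor 4. The scaling by \<open>A * B\<close> occurs twice.\<close>
    have "(A * B) *s c qone - B *s ?m (c x) x - A *s ?m (c y) y - ?m (c (?m x y)) (?m x y) = (4 * (A * B)\<^sup>2) *s qone"
      by (simp add: c_def rules vec_eq_iff power2_eq_square algebra_simps)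
    then have "(4 * (A * B)\<^sup>2) *s qone = 0" by (simp add: c0)
    then show False using nz by (auto simp: qone_def vec_eq_iff forall_4)
  qed
  then show ?thesis using that cx cy by blast
qed

text \<open>Gram-Schmidt with cleared denominators. With a definite norm it also yields the
  Cauchy-Schwarz inequality and its equality case.\<close>

lemma qgram_orthogonal_component:
  assumes "qgram a b x y = n"
  defines "e \<equiv> qnr a b x *s y - qip a b x y *s x"
  shows "qip a b x e = 0" "qnr a b e = qnr a b x * n"
  using assms
  by (simp_all add: qgram_def qnr_eq_qip qip_linear qip_commute[of a b y x] power2_eq_square algebra_simps)

text \<open>Equal norms and inner products survive orthogonalization, so an intertwiner of the
  orthogonal pairs exists; definiteness makes it invertible.\<close>

lemma skolem_noether_pure:
  assumes neg: "a < 0" "b < 0"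
    and pure: "x $ 1 = 0" "y $ 1 = 0" "x' $ 1 = 0" "y' $ 1 = 0"
    and eq: "qnr a b x' = qnr a b x" "qnr a b y' = qnr a b y" "qip a b x' y' = qip a b x y"
    and gram: "qgram a b x y \<noteq> 0"
  obtains c d where "c \<noteq> 0" "qmult a b c d = qone" "qmult a b d c = qone"
    "qmult a b (qmult a b c x) d = x'" "qmult a b (qmult a b c y) d = y'"
proof -
  let ?m = "qmult a b"
  define A where "A = qnr a b x"
  define s where "s = qip a b x y"
  define e where "e = A *s y - s *s x"
  define e' where "e' = A *s y' - s *s x'"
  have "x \<noteq> 0" using gram by (auto simp: qgram_def qnr_eq_qip qip_def)
  then have A: "A \<noteq> 0" using qnr_pos[OF neg] unfolding A_def by fastforce
  have eo: "qip a b x e = 0" "qnr a b e = A * qgram a b x y"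
    unfolding e_def A_def s_def by (rule qgram_orthogonal_component[OF refl])+
  have "qgram a b x' y' = qgram a b x y" using eq by (simp add: qgram_def)
  then have eo': "qip a b x' e' = 0" "qnr a b e' = A * qgram a b x y"
    using qgram_orthogonal_component[of a b x' y' "qgram a b x y"] eq
    unfolding e'_def A_def s_def by simp_all
  obtain c where c: "c \<noteq> 0" "?m c x = ?m x' c" "?m c e = ?m e' c"
  proof (rule intertwiner_exists[of A "A * qgram a b x y" x a b x' e e'])
    show "e $ 1 = 0" "e' $ 1 = 0" using pure by (simp_all add: e_def e'_def)
  qed (use A gram pure eq eo eo' in \<open>auto simp: A_def\<close>)
  have "A *s ?m c y = ?m c e + s *s ?m c x" by (simp add: e_def qmult_linear)
  also have "\<dots> = A *s ?m y' c" by (simp add: c e'_def qmult_linear)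
  finally have cy: "?m c y = ?m y' c" using A by simp
  define d where "d = (1 / qnr a b c) *s qconj c"
  have n: "qnr a b c \<noteq> 0" using qnr_pos[OF neg c(1)] by simp
  have conj': "?m (qconj c) c = qnr a b c *s qone"
    by (simp add: vec_eq_iff forall_4 qnr_def qmult_def qconj_def qone_def)
  have cd: "?m c d = qone" and dc: "?m d c = qone"
    using n by (simp_all add: d_def qmult_linear qnr_qone conj')
  have "?m (?m c x) d = x'" "?m (?m c y) d = y'"
    by (simp_all add: c cy qmult_assoc cd)
  then show ?thesis using that c(1) cd dc by blast
qed

lemma qgram_0_imp_parallel:
  assumes neg: "a < 0" "b < 0" and g: "qgram a b x y = 0"
  shows "qnr a b x *s y = qip a b x y *s x"
proof -
  have "qnr a b (qnr a b x *s y - qip a b x y *s x) = 0"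
    using qgram_orthogonal_component(2)[OF g] by simp
  then show ?thesis using qnr_pos[OF neg] by (metis less_irrefl eq_iff_diff_eq_0)
qed

subsection \<open>Primitive vectors\<close>

lemma primitive_in_imp_mem:
  assumes "primitive_in n L x" shows "x \<in> L"
  using assms by (auto simp: primitive_in_def lattice_basis_def)

text \<open>The reduced denominator of \<open>r\<close> divides every coordinate of
  \<open>x\<close>, hence their gcd, which is 1.\<close>

lemma primitive_in_scale_imp_Ints:
  assumes x: "primitive_in n L x" and r: "r *s x \<in> L"
  shows "r \<in> \<int>"
proof -
  obtain v c where v: "lattice_basis n v L" and xc: "x = (\<Sum>i<n. rat_of_int (c i) *s v i)"
    and gcd: "Gcd (c ` {..<n}) = 1"
    using x by (auto simp: primitive_in_def)
  have inj: "inj_on v {..<n}" and ind: "vec.independent (v ` {..<n})"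
    using v by (auto simp: lattice_basis_def)
  obtain d where d: "r *s x = (\<Sum>i<n. rat_of_int (d i) *s v i)"
    using r v unfolding lattice_basis_def by blast
  have rd: "r * of_int (c i) = of_int (d i)" if i: "i < n" for i
  proof -
    \<comment> \<open>Independence concerns the set of basis vectors, so the coefficients are pulled
      back from indices along \<open>v\<close>.\<close>
    let ?u = "\<lambda>w. r * of_int (c (inv_into {..<n} v w)) - of_int (d (inv_into {..<n} v w))"
    have "(\<Sum>w\<in>v ` {..<n}. ?u w *s w) = (\<Sum>j<n. (r * of_int (c j) - of_int (d j)) *s v j)"
      by (subst sum.reindex[OF inj]) (simp add: inv_into_f_f[OF inj])
    also have "\<dots> = r *s x - (\<Sum>j<n. rat_of_int (d j) *s v j)"
      by (simp add: xc vec.scale_left_diff_distrib sum_subtractf vec.scale_sum_right)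
    also have "\<dots> = 0" using d by simp
    finally have "?u (v i) = 0"
      by (rule vec.independentD[OF ind finite_imageI[OF finite_lessThan] subset_refl]) (use i in auto)
    then show ?thesis using i by (simp add: inv_into_f_f[OF inj])
  qed
  obtain m k where mk: "r = of_int m / of_int k" "k > 0" "coprime m k" by (rule rat_fraction)
  have "k dvd c i" if i: "i < n" for i
  proof -
    have "of_int (m * c i) = (of_int (k * d i) :: rat)" using rd[OF i] mk by (simp add: field_simps)
    then have "m * c i = k * d i" by (simp only: of_int_eq_iff)
    then have "k dvd m * c i" by simp
    then show ?thesis using mk(3) by (simp add: coprime_commute coprime_dvd_mult_right_iff)
  qed
  then have "k dvd Gcd (c ` {..<n})" by (intro Gcd_greatest) auto
  then have "k = 1" using gcd mk by simp
  then show ?thesis using mk by simp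
qed

lemma primitive_in_parallel:
  assumes x: "primitive_in n L x" and y: "primitive_in n L y" and r: "y = r *s x" and y0: "y \<noteq> 0"
  shows "y = x \<or> y = - x"
proof -
  have r0: "r \<noteq> 0" using r y0 by auto
  have "r \<in> \<int>" using primitive_in_scale_imp_Ints[OF x, of r] primitive_in_imp_mem[OF y] r by simp
  then obtain k where k: "r = of_int k" by (auto elim: Ints_cases)
  have "(1 / r) *s y = x" using r r0 by simp
  then have "1 / r \<in> \<int>" using primitive_in_scale_imp_Ints[OF y] primitive_in_imp_mem[OF x] by simp
  then obtain l where l: "1 / r = of_int l" by (auto elim: Ints_cases)
  have "of_int (k * l) = (1::rat)" using k l r0 by (metis nonzero_mult_div_cancel_left of_int_mult times_divide_eq_right mult_1_right)
  then have "k * l = 1" by (metis of_int_eq_1_iff)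
  then have "k = 1 \<or> k = - 1" by (simp add: zmult_eq_1_iff) blast
  then show ?thesis using r k by auto
qed

subsection \<open>Isometric pairs in two trace lattices\<close>

lemma qgram_nonneg:
  assumes neg: "a < 0" "b < 0" shows "qgram a b x y \<ge> 0"
proof (cases "x = 0")
  case True
  then show ?thesis by (simp add: qgram_def qnr_eq_qip qip_def)
next
  case False
  then have x: "qnr a b x > 0" using neg by (intro qnr_pos)
  have nn: "qnr a b u \<ge> 0" for u using qnr_pos[OF neg, of u] by (cases "u = 0") (auto simp: qnr_eq_qip qip_def)
  have "qnr a b x * qgram a b x y \<ge> 0"
    unfolding qgram_orthogonal_component(2)[OF refl, symmetric] by (rule nn)
  then show ?thesis using x by (simp add: zero_le_mult_iff)
qed

lemma trace_lattice_eq_qpure: "trace_lattice R = qpure ` R"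
  by (simp add: trace_lattice_def qpure_def[abs_def])

context ramified_order
begin

lemma trace_lattice_diff: "x \<in> trace_lattice R \<Longrightarrow> y \<in> trace_lattice R \<Longrightarrow> x - y \<in> trace_lattice R"
  using diff_mem by (auto simp: trace_lattice_eq_qpure simp flip: qpure_diff)

lemma trace_lattice_uminus: "x \<in> trace_lattice R \<Longrightarrow> - x \<in> trace_lattice R"
  using minus_mem by (auto simp: trace_lattice_eq_qpure simp flip: qpure_uminus)

lemma trace_lattice_qip_Ints:
  "x \<in> trace_lattice R \<Longrightarrow> y \<in> trace_lattice R \<Longrightarrow> qip a b x y \<in> \<int>"
  using qpure_qip_Ints by (auto simp: trace_lattice_eq_qpure)

text \<open>Since \<open>qgram\<close> is at most the product of the norms, a bound on that product
  leaves only a few multiples of \<open>4p\<close>.\<close>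

lemma trace_lattice_qgram:
  assumes x: "x \<in> trace_lattice R" and y: "y \<in> trace_lattice R" and nz: "qgram a b x y \<noteq> 0"
    and bd: "qnr a b x * qnr a b y < 4 * of_nat p * of_int k"
  obtains m :: int where "qgram a b x y = 4 * of_nat p * of_int m" "1 \<le> m" "m < k"
proof -
  obtain m :: int where m: "qgram a b x y = 4 * of_nat p * of_int m"
    using x y qgram_multiple unfolding trace_lattice_eq_qpure by blast
  have p0: "0 < 4 * rat_of_nat p" using p_gt_2 by simp
  have "0 < qgram a b x y" using qgram_nonneg[OF neg, of x y] nz by simp
  then have "0 < m" using m p0 by (simp add: zero_less_mult_iff)
  have "4 * of_nat p * rat_of_int m < 4 * of_nat p * of_int k"
    using m bd zero_le_power2[of "qip a b x y"] unfolding qgram_def by linarith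
  then have "m < k" using p0 by (simp add: mult_less_cancel_left_pos)
  with \<open>0 < m\<close> show ?thesis by (intro that[OF m]) auto
qed

text \<open>A trace lattice vector determines its preimage up to integers, and its norm modulo 4
  determines the parity of the trace; any \<open>t\<close> of that parity is attained.\<close>

lemma half_trace_lattice_mem:
  assumes x: "x \<in> trace_lattice R" and n: "qnr a b x = of_int (4 * n - t\<^sup>2)"
  shows "(1 / 2) *s (x + of_int t *s qone) \<in> R"
proof -
  obtain u where u: "u \<in> R" "x = qpure u" using x by (auto simp: trace_lattice_eq_qpure)
  obtain r where r: "qtr u = of_int r" using qtr_Ints[OF u(1)] by (auto elim: Ints_cases)
  obtain A where A: "qnr a b u = of_int A" using qnr_Ints[OF u(1)] by (auto elim: Ints_cases)
  have "rat_of_int (4 * n - t\<^sup>2) = of_int (4 * A - r\<^sup>2)"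
    unfolding n[symmetric] u(2) using A r by (simp add: qnr_eq_qip qip_qpure power2_eq_square)
  then have "4 * n - t\<^sup>2 = 4 * A - r\<^sup>2" by (simp only: of_int_eq_iff)
  then have "t\<^sup>2 - r\<^sup>2 = 2 * (2 * (n - A))" by simp
  then have "even (t\<^sup>2 - r\<^sup>2)" by (metis dvd_triv_left)
  then have "even (t - r)" by simp
  then obtain k where k: "t = r + 2 * k" by (metis evenE diff_add_cancel add.commute)
  have "(1 / 2) *s (x + of_int t *s qone) = u + of_int k *s qone"
    by (simp add: u(2) qpure_def r k vec_eq_iff field_simps)
  then show ?thesis using u(1) one_mem by (simp add: add_mem int_scale_mem)
qed

end

lemma same_type_if_isometric_pairs:
  assumes R: "ramified_order p a b R" and R': "ramified_order p a b R'"
    and x: "x \<in> trace_lattice R" and y: "y \<in> trace_lattice R"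
    and x': "x' \<in> trace_lattice R'" and y': "y' \<in> trace_lattice R'"
    and eq: "qnr a b x' = qnr a b x" "qnr a b y' = qnr a b y" "qip a b x' y' = qip a b x y"
    and gram: "qgram a b x y = 4 * of_nat p"
  shows "same_type a b R R'"
proof -
  interpret R: ramified_order p a b R by (rule R)
  interpret R': ramified_order p a b R' by (rule R')
  obtain u where u: "u \<in> R" "x = qpure u" using x by (auto simp: trace_lattice_eq_qpure)
  obtain w where w: "w \<in> R" "y = qpure w" using y by (auto simp: trace_lattice_eq_qpure)
  obtain t where t: "qtr u = of_int t" using R.qtr_Ints[OF u(1)] by (auto elim: Ints_cases)
  obtain r where r: "qtr w = of_int r" using R.qtr_Ints[OF w(1)] by (auto elim: Ints_cases)
  obtain A where A: "qnr a b u = of_int A" using R.qnr_Ints[OF u(1)] by (auto elim: Ints_cases)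
  obtain C where C: "qnr a b w = of_int C" using R.qnr_Ints[OF w(1)] by (auto elim: Ints_cases)
  \<comment> \<open>The trace \<open>t\<close> of \<open>u\<close> is admissible in
    \<open>R'\<close> because \<open>x\<close> and \<open>x'\<close> have equal norms. Equal traces
    make the conjugation carry \<open>u\<close> to \<open>u'\<close>, and likewise \<open>w\<close>
    to \<open>w'\<close>.\<close>
  define u' where "u' = (1 / 2) *s (x' + of_int t *s qone)"
  define w' where "w' = (1 / 2) *s (y' + of_int r *s qone)"
  have "qnr a b x' = of_int (4 * A - t\<^sup>2)"
    using eq u A t by (simp add: qnr_eq_qip qip_qpure power2_eq_square)
  then have u': "u' \<in> R'" unfolding u'_def by (rule R'.half_trace_lattice_mem[OF x'])
  have "qnr a b y' = of_int (4 * C - r\<^sup>2)"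
    using eq w C r by (simp add: qnr_eq_qip qip_qpure power2_eq_square)
  then have w': "w' \<in> R'" unfolding w'_def by (rule R'.half_trace_lattice_mem[OF y'])
  have pure: "x $ 1 = 0" "y $ 1 = 0" "x' $ 1 = 0" "y' $ 1 = 0"
    using x y x' y' by (auto simp: trace_lattice_eq_qpure)
  have pu: "qpure u' = x'" "qpure w' = y'"
    using pure by (simp_all add: u'_def w'_def vec_eq_iff forall_4 qpure_def qtr_def qconj_def qone_def)
  have gram': "qgram a b x' y' = 4 * of_nat p" using gram eq by (simp add: qgram_def)
  have p0: "rat_of_nat p > 0" using R.p_gt_2 by simp
  obtain c d where cd: "c \<noteq> 0" "qmult a b c d = qone" "qmult a b d c = qone"
    and cx: "qmult a b (qmult a b c x) d = x'" and cy: "qmult a b (qmult a b c y) d = y'"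
    using skolem_noether_pure[OF R.neg pure eq] gram p0 by auto
  define F where "F q = qmult a b (qmult a b c q) d" for q
  have F1: "F qone = qone" by (simp add: F_def cd)
  have Flin: "F (q + q') = F q + F q'" "F (k *s q) = k *s F q" for q q' k
    by (simp_all add: F_def qmult_linear)
  have Fmult: "F (qmult a b q q') = qmult a b (F q) (F q')" for q q'
  proof -
    have "qmult a b d (qmult a b c z) = z" for z by (simp add: cd qmult_assoc[symmetric])
    then show ?thesis by (simp add: F_def qmult_assoc)
  qed
  have "u = (1 / 2) *s (x + of_int t *s qone)" "w = (1 / 2) *s (y + of_int r *s qone)"
    using t r by (simp_all add: u(2) w(2) qpure_def)
  then have Fu: "F u = u'" and Fw: "F w = w'"
    using cx cy F1 by (simp_all add: Flin u'_def w'_def F_def[of x] F_def[of y])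
  have span: "R = {of_int k0 *s qone + of_int k1 *s u + of_int k2 *s w + of_int k3 *s qmult a b u w
               | k0 k1 k2 k3. True}"
    using gram u w by (intro R.order_eq_span) auto
  have span': "R' = {of_int k0 *s qone + of_int k1 *s u' + of_int k2 *s w' + of_int k3 *s qmult a b u' w'
               | k0 k1 k2 k3. True}"
    using gram' pu u' w' by (intro R'.order_eq_span) auto
  have "F (of_int k0 *s qone + of_int k1 *s u + of_int k2 *s w + of_int k3 *s qmult a b u w)
      = of_int k0 *s qone + of_int k1 *s u' + of_int k2 *s w' + of_int k3 *s qmult a b u' w'" for k0 k1 k2 k3
    by (simp add: Flin Fmult F1 Fu Fw)
  then have "F ` R = R'" by (subst span, subst span') (auto simp: image_iff; metis)
  then show ?thesis using cd unfolding same_type_def F_def by blast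
qed

text \<open>Here \<open>A\<close> is the common norm of the pair, \<open>s\<close> the absolute
  value of its inner product, and \<open>t\<close> the inner product of vectors of norms
  \<open>A\<close> and \<open>2A - 2s\<close>. \<open>A = 2s\<close> would give
  \<open>3 s^2 = 4p\<close>. For \<open>m = 2\<close>, \<open>t^2 = -2s(A - s)\<close> forces
  \<open>s = 0\<close> and \<open>A^2 = 4p\<close>, impossible for \<open>p > 3\<close>.\<close>

lemma equal_norm_case_arith:
  fixes A s t p :: int
  assumes p: "prime p" "p > 3" and s: "0 \<le> s" "2 * s \<le> A" "0 < A"
    and gram: "A\<^sup>2 - s\<^sup>2 = 4 * p"
  shows "2 * s \<noteq> A"
    and "A * (2 * A - 2 * s) - t\<^sup>2 = 4 * p * m \<Longrightarrow> 1 \<le> m \<Longrightarrow> m < 3 \<Longrightarrow> t = A - s \<or> t = - (A - s)"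
proof -
  show "2 * s \<noteq> A"
  proof
    assume "2 * s = A"
    then have "A\<^sup>2 - s\<^sup>2 = 3 * s\<^sup>2" by (auto simp: power2_eq_square)
    then have "3 dvd 4 * p" using gram by (metis dvd_triv_left)
    then have "3 dvd p" by presburger
    then show False using p unfolding prime_int_iff by (metis less_irrefl numeral_eq_one_iff semiring_norm(84) zero_le_numeral)
  qed
  assume t: "A * (2 * A - 2 * s) - t\<^sup>2 = 4 * p * m" and m: "1 \<le> m" "m < 3"
  then consider "m = 1" | "m = 2" by linarith
  then show "t = A - s \<or> t = - (A - s)"
  proof cases
    case 1
    then have "t\<^sup>2 = (A - s)\<^sup>2" using t gram by (simp add: power2_eq_square algebra_simps)
    then show ?thesis by (simp only: power2_eq_iff)
  next
    case 2
    then have "t\<^sup>2 = - (2 * s * (A - s))" using t gram by (simp add: power2_eq_square algebra_simps)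
    moreover have "2 * s * (A - s) \<ge> 0" using s by simp
    ultimately have "2 * s * (A - s) = 0" using zero_le_power2[of t] by linarith
    then have "s = 0" using s by auto
    then have A2: "A * A = 4 * p" using gram by (simp add: power2_eq_square)
    then have "p dvd A" using p prime_dvd_mult_iff[of p A A] by (metis dvd_triv_right)
    then obtain k where "A = p * k" by blast
    then have "p * (p * k * k) = p * 4" using A2 by (simp add: algebra_simps)
    then have "p * (k * k) = 4" using p by simp
    then have "p dvd 4" by (metis dvd_triv_left)
    then have "p \<le> 4" by (simp add: zdvd_imp_le)
    then have "p = 4" using p by simp
    then show ?thesis using p by (simp add: prime_int_numeral_eq)
  qed
qed

lemma isometric_pair_exists:
  assumes "ramified_order p a b R" "ramified_order p a b R'" and p3: "p > 3"
    and x: "x \<in> trace_lattice R" and y: "y \<in> trace_lattice R"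
    and gram: "qgram a b x y = 4 * of_nat p" and bd: "3 * (qnr a b x * qnr a b y) < 16 * of_nat p"
    and min: "\<And>v. v \<in> trace_lattice R \<Longrightarrow> v \<noteq> 0 \<Longrightarrow> qnr a b x \<le> qnr a b v"
    and x1: "primitive_in 3 (trace_lattice R') x1" "qnr a b x1 = qnr a b x"
    and y1: "primitive_in 3 (trace_lattice R') y1" "qnr a b y1 = qnr a b y"
    and plus: "primitive_in 3 (trace_lattice R') w1" "qnr a b w1 = qnr a b (x + y)"
    and minus: "primitive_in 3 (trace_lattice R') w2" "qnr a b w2 = qnr a b (x - y)"
  obtains x' y' where "x' \<in> trace_lattice R'" "y' \<in> trace_lattice R'"
    "qnr a b x' = qnr a b x" "qnr a b y' = qnr a b y" "qip a b x' y' = qip a b x y"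
proof -
  interpret R: ramified_order p a b R by fact
  interpret R': ramified_order p a b R' by fact
  let ?T = "trace_lattice R'"
  note neg = R.neg
  have p0: "rat_of_nat p > 0" using p3 by simp
  have x1T: "x1 \<in> ?T" and y1T: "y1 \<in> ?T" using x1 y1 primitive_in_imp_mem by blast+
  have "x \<noteq> 0" "y \<noteq> 0" using gram p0 by (auto simp: qgram_def qnr_eq_qip qip_def)
  then have pos: "qnr a b x > 0" "qnr a b y > 0" using qnr_pos[OF neg] by auto
  note witness = that
  \<comment> \<open>A Gram determinant fixes the inner product only up to sign, which replacing
    \<open>y'\<close> by \<open>- y'\<close> repairs.\<close>
  have thesis_if_abs: thesis if x': "x' \<in> ?T" "qnr a b x' = qnr a b x" and y': "y' \<in> ?T" "qnr a b y' = qnr a b y"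
    and s: "\<bar>qip a b x' y'\<bar> = \<bar>qip a b x y\<bar>" for x' y'
  proof (cases "qip a b x' y' = qip a b x y")
    case True
    then show ?thesis using witness x' y' by blast
  next
    case False
    then have "qip a b x' (- y') = qip a b x y" using s by (auto simp: qip_uminus abs_eq_iff)
    moreover have "qnr a b (- y') = qnr a b y" using y' by (simp add: qnr_eq_qip qip_uminus)
    ultimately show ?thesis using witness x' R'.trace_lattice_uminus[OF y'(1)] by blast
  qed
  have parallel: "qnr a b w = qnr a b x"
    if "primitive_in 3 ?T w" "qgram a b x1 w = 0" "w \<noteq> 0" for w
  proof -
    have "qnr a b x *s w = qip a b x1 w *s x1" using qgram_0_imp_parallel[OF neg that(2)] x1 by simp
    then have "(1 / qnr a b x) *s (qnr a b x *s w) = (1 / qnr a b x) *s (qip a b x1 w *s x1)" by simp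
    then have "w = (qip a b x1 w / qnr a b x) *s x1" using pos by simp
    then have "w = x1 \<or> w = - x1" using primitive_in_parallel[OF x1(1) that(1)] that(3) by blast
    then show ?thesis using x1 by (auto simp: qnr_eq_qip qip_uminus)
  qed
  show ?thesis
  proof (cases "qgram a b x1 y1 = 0")
    case False
    obtain m where "qgram a b x1 y1 = 4 * of_nat p * of_int m" "1 \<le> m" "m < 2"
      using R'.trace_lattice_qgram[OF x1T y1T False, of 2] bd x1 y1 p0 by auto
    then have "qgram a b x1 y1 = qgram a b x y" using gram by simp
    then have "(qip a b x1 y1)\<^sup>2 = (qip a b x y)\<^sup>2" using x1 y1 by (simp add: qgram_def)
    then have "\<bar>qip a b x1 y1\<bar> = \<bar>qip a b x y\<bar>" by (simp add: power2_eq_iff abs_eq_iff)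
    then show ?thesis using thesis_if_abs x1T x1 y1T y1 by blast
  next
    case True
    have "y1 \<noteq> 0" using y1 pos by (auto simp: qnr_eq_qip qip_def)
    then have eqn: "qnr a b y = qnr a b x" using parallel[OF y1(1) True] y1 by simp
    obtain A where A: "qnr a b x = of_int A"
      using R.trace_lattice_qip_Ints[OF x x] by (auto simp: qnr_eq_qip elim: Ints_cases)
    obtain s0 where s0: "qip a b x y = of_int s0"
      using R.trace_lattice_qip_Ints[OF x y] by (auto elim: Ints_cases)
    define s where "s = \<bar>s0\<bar>"
    \<comment> \<open>The sign selects the shorter of \<open>x - y\<close> and \<open>x + y\<close>,
      of norm \<open>2A - 2s\<close>; \<open>w\<close> is its counterpart in the other
      lattice.\<close>
    define w0 where "w0 = (if s0 \<ge> 0 then x - y else x + y)"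
    define w where "w = (if s0 \<ge> 0 then w2 else w1)"
    have w0n: "qnr a b w0 = of_int (2 * A - 2 * s)"
      using eqn A s0 by (simp add: w0_def s_def qnr_eq_qip qip_linear qip_commute[of a b y x])
    have w: "primitive_in 3 ?T w" "qnr a b w = of_int (2 * A - 2 * s)"
      using plus minus w0n by (auto simp: w_def w0_def split: if_splits)
    have wT: "w \<in> ?T" using w primitive_in_imp_mem by blast
    have "x + y = x - (- y)" by simp
    then have w0T: "w0 \<in> trace_lattice R"
      using R.trace_lattice_diff[OF x y] R.trace_lattice_diff[OF x R.trace_lattice_uminus[OF y]]
      by (simp add: w0_def)
    have "rat_of_int (A\<^sup>2 - s\<^sup>2) = of_int (4 * int p)"
      using gram by (simp add: qgram_def eqn A s0 s_def power2_eq_square)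
    then have g: "A\<^sup>2 - s\<^sup>2 = 4 * int p" by (simp only: of_int_eq_iff)
    have A0: "A > 0" using pos A by simp
    have pp: "prime (int p)" "int p > 3" using R.prime_p p3 by auto
    have "s \<noteq> A" using g pp by auto
    then have "w0 \<noteq> 0" using w0n by (auto simp: qnr_eq_qip qip_def)
    \<comment> \<open>Minimality of \<open>x\<close> makes the pair reduced,
      \<open>2 s \<le> A\<close>.\<close>
    then have "rat_of_int A \<le> of_int (2 * A - 2 * s)" using min[OF w0T] A w0n by simp
    then have sA: "2 * s \<le> A" by (simp only: of_int_le_iff)
    have s_nn: "0 \<le> s" by (simp add: s_def)
    note arith = equal_norm_case_arith[OF pp s_nn sA A0 g]
    have "w \<noteq> 0" using w(2) sA A0 s_nn by (auto simp: qnr_eq_qip qip_def)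
    have nz: "qgram a b x1 w \<noteq> 0"
    proof
      assume "qgram a b x1 w = 0"
      from parallel[OF w(1) this \<open>w \<noteq> 0\<close>] have "rat_of_int (2 * A - 2 * s) = of_int A" using w(2) A by simp
      then have "2 * A - 2 * s = A" by (simp only: of_int_eq_iff)
      then show False using arith(1) by simp
    qed
    have "rat_of_int (3 * (A * A)) < of_int (16 * int p)" using bd eqn A by simp
    then have AA: "3 * (A * A) < 16 * int p" by (simp only: of_int_less_iff)
    \<comment> \<open>The constant 16/3 is used here: \<open>2 A^2 < 32p/3 < 12p\<close> excludes
      \<open>m \<ge> 3\<close>.\<close>
    have "A * (2 * A - 2 * s) \<le> A * (2 * A)" using A0 s_nn by (intro mult_left_mono) auto
    then have "A * (2 * A - 2 * s) < 4 * int p * 3" using AA by simp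
    then have "rat_of_int (A * (2 * A - 2 * s)) < of_int (4 * int p * 3)" by (simp only: of_int_less_iff)
    then have "qnr a b x1 * qnr a b w < 4 * of_nat p * of_int 3" using w x1 A by simp
    then obtain m where m: "qgram a b x1 w = 4 * of_nat p * of_int m" "1 \<le> m" "m < 3"
      using R'.trace_lattice_qgram[OF x1T wT nz] by blast
    obtain t where t: "qip a b x1 w = of_int t"
      using R'.trace_lattice_qip_Ints[OF x1T wT] by (auto elim: Ints_cases)
    have "rat_of_int (A * (2 * A - 2 * s) - t\<^sup>2) = of_int (4 * int p * m)"
      using m(1) by (simp add: qgram_def x1 A w t)
    then have "A * (2 * A - 2 * s) - t\<^sup>2 = 4 * int p * m" by (simp only: of_int_eq_iff)
    then have tt: "t = A - s \<or> t = - (A - s)" using arith(2) m by blast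
    define w' where "w' = (if t = A - s then w else - w)"
    have w': "w' \<in> ?T" using wT R'.trace_lattice_uminus by (simp add: w'_def)
    have ipw: "qip a b x1 w' = of_int (A - s)" "qip a b w' w' = of_int (2 * A - 2 * s)"
      using tt t w by (auto simp: w'_def qip_uminus qnr_eq_qip)
    show ?thesis
    proof (rule thesis_if_abs[OF x1T x1(2)])
      \<comment> \<open>Mirrors \<open>y = x - (x - y)\<close>: the norm is
        \<open>A - 2(A - s) + (2A - 2s) = A\<close>, the inner product with \<open>x1\<close> is
        \<open>s\<close>.\<close>
      show "x1 - w' \<in> ?T" by (rule R'.trace_lattice_diff[OF x1T w'])
      have x1n: "qip a b x1 x1 = of_int A" using x1 A by (simp add: qnr_eq_qip)
      show "qnr a b (x1 - w') = qnr a b y"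
        unfolding eqn A by (simp add: qnr_eq_qip qip_linear qip_commute[of a b w' x1] ipw x1n)
      show "\<bar>qip a b x1 (x1 - w')\<bar> = \<bar>qip a b x y\<bar>"
        by (simp add: qip_linear ipw x1n s0 s_def)
    qed
  qed
qed

section \<open>From minima and optimal representations to the type\<close>

theorem theorem3p2:
  fixes p :: nat and a b :: rat and R R' :: "quat set"
    and D1 D2 D3 :: real and x y z :: quat
  assumes "prime p"
    and "ramified_exactly_at_p_and_infinity p a b"
    and "is_maximal_order a b R" and "is_maximal_order a b R'"
    and "is_successive_minimum a b (trace_lattice R) 1 D1"
    and "is_successive_minimum a b (trace_lattice R) 2 D2"
    and "is_successive_minimum a b (trace_lattice R) 3 D3"
    and "x \<in> trace_lattice R" and "y \<in> trace_lattice R" and "z \<in> trace_lattice R"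
    and "distinct [x, y, z]" and "vec.independent {x, y, z}"
    and "real_of_rat (qnr a b x) = D1"
    and "real_of_rat (qnr a b y) = D2"
    and "real_of_rat (qnr a b z) = D3"
    and "represented_optimally a b 3 (trace_lattice R') D1"
    and "represented_optimally a b 3 (trace_lattice R') D2"
    and "represented_optimally a b 3 (trace_lattice R') (real_of_rat (qnr a b (x + y)))"
    and "represented_optimally a b 3 (trace_lattice R') (real_of_rat (qnr a b (x - y)))"
    and "represented_optimally a b 3 (trace_lattice R') D3"
    and "optimal_multiplicity a b 3 (trace_lattice R) D3
           \<le> optimal_multiplicity a b 3 (trace_lattice R') D3"
    and "D1 * D2 < 16 / 3 * real p"
    and "15 \<le> D1"
    and "286 < p"
  shows "same_type a b R R'"
proof -
  have neg: "a < 0" "b < 0" and ram: "ramified_at (padic_abs p) a b"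
    using assms(1,2) ramified_at_infinity_imp_negative
    unfolding ramified_exactly_at_p_and_infinity_def by blast+
  have R: "ramified_order p a b R" and R': "ramified_order p a b R'"
    using assms(1,3,4,24) neg ram by (auto simp: ramified_order_def is_maximal_order_def)
  have "real_of_rat (3 * (qnr a b x * qnr a b y)) < real_of_rat (16 * of_nat p)"
    using assms(13,14,22) by (simp add: of_rat_mult)
  then have bd: "3 * (qnr a b x * qnr a b y) < 16 * of_nat p" by (simp only: of_rat_less)
  have p0: "rat_of_nat p > 0" using assms(24) by simp
  have gram: "qgram a b x y = 4 * of_nat p"
  proof -
    have nz: "qgram a b x y \<noteq> 0"
    proof
      assume "qgram a b x y = 0"
      then have par: "qnr a b x *s y = qip a b x y *s x" by (rule qgram_0_imp_parallel[OF neg])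
      have "qnr a b x \<noteq> 0" using assms(13,23) by auto
      then have "y = (qip a b x y / qnr a b x) *s x"
        using arg_cong[OF par, of "\<lambda>v. (1 / qnr a b x) *s v"] by simp
      then have "y \<in> vec.span ({x, y, z} - {y})"
        using assms(11) by (metis vec.span_scale vec.span_base Diff_iff insertI1 distinct_length_2_or_more singletonD)
      then show False using assms(12) unfolding vec.dependent_def by blast
    qed
    obtain m where "qgram a b x y = 4 * of_nat p * of_int m" "1 \<le> m" "m < 2"
      using ramified_order.trace_lattice_qgram[OF R assms(8,9) nz, of 2] bd p0 by auto
    then show ?thesis by simp
  qed
  \<comment> \<open>The singleton \<open>{v}\<close> competes in the definition of the first
    minimum.\<close>
  have min: "qnr a b x \<le> qnr a b v" if v: "v \<in> trace_lattice R" "v \<noteq> 0" for v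
  proof -
    have "\<exists>S\<subseteq>trace_lattice R. finite S \<and> card S = 1 \<and> vec.independent S \<and>
        (\<forall>s\<in>S. real_of_rat (qnr a b s) \<le> real_of_rat (qnr a b v))"
      using v by (intro exI[of _ "{v}"]) auto
    then have "D1 \<le> real_of_rat (qnr a b v)"
      using assms(5) unfolding is_successive_minimum_def Let_def by blast
    then show ?thesis unfolding assms(13)[symmetric] by (simp only: of_rat_less_eq)
  qed
  have rep: "\<exists>v. primitive_in 3 (trace_lattice R') v \<and> qnr a b v = r"
    if "represented_optimally a b 3 (trace_lattice R') (real_of_rat r)" for r
    using that unfolding represented_optimally_def by simp
  obtain x1 y1 w1 w2 where reps:
    "primitive_in 3 (trace_lattice R') x1" "qnr a b x1 = qnr a b x"
    "primitive_in 3 (trace_lattice R') y1" "qnr a b y1 = qnr a b y"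
    "primitive_in 3 (trace_lattice R') w1" "qnr a b w1 = qnr a b (x + y)"
    "primitive_in 3 (trace_lattice R') w2" "qnr a b w2 = qnr a b (x - y)"
    using rep[of "qnr a b x"] rep[of "qnr a b y"] rep[OF assms(18)] rep[OF assms(19)] assms(13,14,16,17)
    by auto
  obtain x' y' where "x' \<in> trace_lattice R'" "y' \<in> trace_lattice R'"
    "qnr a b x' = qnr a b x" "qnr a b y' = qnr a b y" "qip a b x' y' = qip a b x y"
    using isometric_pair_exists[OF R R' _ assms(8,9) gram bd min reps] assms(24) by auto
  then show ?thesis using same_type_if_isometric_pairs[OF R R' assms(8,9)] gram by blast
qed

end
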